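(* For a graph $G$ the following conditions are equivalent: (i) $G$ is a dual polar graph; (ii) $G$ is a thick weakly modular graph not containing induced $K_4^-$ and not containing isometric $K_{3,3}^-$; (iii) $G$ is a thick locally weakly modular graph not containing induced $K_4^-$ and not containing isometric $K_{3,3}^-$, and the triangle-square complex of $G$ is simply connected.
   Context: Graphs are simple, undirected, connected, possibly infinite; $d$ is graph distance, $I(u,v)=\{x:d(u,x)+d(x,v)=d(u,v)\}$. An induced subgraph $H$ is gated if each vertex $x$ has $x'\in H$ with $x'\in I(x,y)$ for all $y\in H$; the gated hull $\langle S\rangle$ of a set $S$ is the smallest gated set containing it. A dual polar graph is a graph satisfying: (A1) every maximal clique is gated; (A3\&4) the gated hull of any two vertices at distance $2$ has diameter $2$; (A5) for every pair of nonadjacent vertices $u,v$ and every neighbor $x$ of $u$ in $I(u,v)$ there exists a neighbor $y$ of $v$ in $I(u,v)$ with $d(u,v)=d(x,y)=d(u,y)+1=d(x,v)+1$ (finite diameter is not required). $G$ is thick if for every pair $u,v$ with $d(u,v)=2$ the interval $I(u,v)$ contains an induced $4$--cycle. Weakly modular: for every vertex $u$, (TC) for $v,w$ with $1=d(v,w)<d(u,v)=d(u,w)$ there is a common neighbor $x$ of $v,w$ with $d(u,x)=d(u,v)-1$, and (QC) for $v,w,z$ with $d(v,z)=d(w,z)=1$, $2=d(v,w)\le d(u,v)=d(u,w)=d(u,z)-1$ there is a common neighbor $x$ of $v,w$ with $d(u,x)=d(u,v)-1$. Locally weakly modular: for every $u$, (LTC) for adjacent $v,w$ with $d(u,v)=d(u,w)=2$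 there is a common neighbor of $u,v,w$, and (LQC) for $v,w,z$ with $z\sim v,w$, $d(v,w)=d(u,v)=d(u,w)=d(u,z)-1=2$ there is a common neighbor of $u,v,w$. $K_4^-$ and $K_{3,3}^-$ denote $K_4$ and $K_{3,3}$ minus one edge; an isometric subgraph is one whose distances agree with those of $G$. The triangle-square complex is the $2$--complex with $1$--skeleton $G$ whose $2$--cells are glued along all $3$--cycles and all induced $4$--cycles. *)

theory Defs
  imports Main
begin

definition walk :: "('a \<Rightarrow> 'a \<Rightarrow> bool) \<Rightarrow> 'a list \<Rightarrow> bool" where
  "walk E p \<longleftrightarrow> p \<noteq> [] \<and> (\<forall>i. Suc i < length p \<longrightarrow> E (p ! i) (p ! Suc i))"

definition graph :: "'a set \<Rightarrow> ('a \<Rightarrow> 'a \<Rightarrow> bool) \<Rightarrow> bool" where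
  "graph V E \<longleftrightarrow> V \<noteq> {}
     \<and> (\<forall>u v. E u v \<longrightarrow> u \<in> V \<and> v \<in> V \<and> E v u \<and> u \<noteq> v)
     \<and> (\<forall>u\<in>V. \<forall>v\<in>V. \<exists>p. walk E p \<and> hd p = u \<and> last p = v)"

definition dist :: "('a \<Rightarrow> 'a \<Rightarrow> bool) \<Rightarrow> 'a \<Rightarrow> 'a \<Rightarrow> nat" where
  "dist E u v = (LEAST n. \<exists>p. walk E p \<and> hd p = u \<and> last p = v \<and> length p = Suc n)"

definition interval :: "'a set \<Rightarrow> ('a \<Rightarrow> 'a \<Rightarrow> bool) \<Rightarrow> 'a \<Rightarrow> 'a \<Rightarrow> 'a set" where
  "interval V E u v = {x \<in> V. dist E u x + dist E x v = dist E u v}"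

definition gated :: "'a set \<Rightarrow> ('a \<Rightarrow> 'a \<Rightarrow> bool) \<Rightarrow> 'a set \<Rightarrow> bool" where
  "gated V E H \<longleftrightarrow> H \<subseteq> V \<and>
     (\<forall>x\<in>V. \<exists>x'\<in>H. \<forall>y\<in>H. x' \<in> interval V E x y)"

definition gated_hull :: "'a set \<Rightarrow> ('a \<Rightarrow> 'a \<Rightarrow> bool) \<Rightarrow> 'a set \<Rightarrow> 'a set" where
  "gated_hull V E S = \<Inter>{H. gated V E H \<and> S \<subseteq> H}"

definition induced :: "('a \<Rightarrow> 'a \<Rightarrow> bool) \<Rightarrow> 'a set \<Rightarrow> 'a \<Rightarrow> 'a \<Rightarrow> bool" where
  "induced E H x y \<longleftrightarrow> E x y \<and> x \<in> H \<and> y \<in> H"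

definition dist_le :: "('a \<Rightarrow> 'a \<Rightarrow> bool) \<Rightarrow> 'a \<Rightarrow> 'a \<Rightarrow> nat \<Rightarrow> bool" where
  "dist_le E x y k \<longleftrightarrow> (\<exists>p. walk E p \<and> hd p = x \<and> last p = y \<and> length p \<le> Suc k)"

text \<open>The induced subgraph on H has diameter exactly k (k \<ge> 1).\<close>
definition has_diameter :: "('a \<Rightarrow> 'a \<Rightarrow> bool) \<Rightarrow> 'a set \<Rightarrow> nat \<Rightarrow> bool" where
  "has_diameter E H k \<longleftrightarrow>
     (\<forall>x\<in>H. \<forall>y\<in>H. dist_le (induced E H) x y k) \<and>
     (\<exists>x\<in>H. \<exists>y\<in>H. \<not> dist_le (induced E H) x y (k - 1))"

definition clique :: "('a \<Rightarrow> 'a \<Rightarrow> bool) \<Rightarrow> 'a set \<Rightarrow> bool" where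
  "clique E K \<longleftrightarrow> (\<forall>x\<in>K. \<forall>y\<in>K. x \<noteq> y \<longrightarrow> E x y)"

definition maximal_clique :: "'a set \<Rightarrow> ('a \<Rightarrow> 'a \<Rightarrow> bool) \<Rightarrow> 'a set \<Rightarrow> bool" where
  "maximal_clique V E K \<longleftrightarrow> K \<subseteq> V \<and> clique E K \<and>
     (\<forall>K'. K \<subseteq> K' \<and> K' \<subseteq> V \<and> clique E K' \<longrightarrow> K' = K)"

definition axiom_A1 :: "'a set \<Rightarrow> ('a \<Rightarrow> 'a \<Rightarrow> bool) \<Rightarrow> bool" where
  "axiom_A1 V E \<longleftrightarrow> (\<forall>K. maximal_clique V E K \<longrightarrow> gated V E K)"

definition axiom_A34 :: "'a set \<Rightarrow> ('a \<Rightarrow> 'a \<Rightarrow> bool) \<Rightarrow> bool" where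
  "axiom_A34 V E \<longleftrightarrow> (\<forall>u\<in>V. \<forall>v\<in>V. dist E u v = 2 \<longrightarrow>
      has_diameter E (gated_hull V E {u, v}) 2)"

definition axiom_A5 :: "'a set \<Rightarrow> ('a \<Rightarrow> 'a \<Rightarrow> bool) \<Rightarrow> bool" where
  "axiom_A5 V E \<longleftrightarrow> (\<forall>u\<in>V. \<forall>v\<in>V. \<forall>x. \<not> E u v \<and> E u x \<and> x \<in> interval V E u v \<longrightarrow>
      (\<exists>y. E v y \<and> y \<in> interval V E u v \<and>
           dist E u v = dist E x y \<and> dist E u v = dist E u y + 1 \<and> dist E u v = dist E x v + 1))"

definition dual_polar :: "'a set \<Rightarrow> ('a \<Rightarrow> 'a \<Rightarrow> bool) \<Rightarrow> bool" where
  "dual_polar V E \<longleftrightarrow> axiom_A1 V E \<and> axiom_A34 V E \<and> axiom_A5 V E"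

definition induced_4cycle :: "('a \<Rightarrow> 'a \<Rightarrow> bool) \<Rightarrow> 'a \<Rightarrow> 'a \<Rightarrow> 'a \<Rightarrow> 'a \<Rightarrow> bool" where
  "induced_4cycle E a b c e \<longleftrightarrow> distinct [a, b, c, e] \<and>
     E a b \<and> E b c \<and> E c e \<and> E e a \<and> \<not> E a c \<and> \<not> E b e"

definition thick :: "'a set \<Rightarrow> ('a \<Rightarrow> 'a \<Rightarrow> bool) \<Rightarrow> bool" where
  "thick V E \<longleftrightarrow> (\<forall>u\<in>V. \<forall>v\<in>V. dist E u v = 2 \<longrightarrow>
     (\<exists>a b c e. {a, b, c, e} \<subseteq> interval V E u v \<and> induced_4cycle E a b c e))"

definition weakly_modular :: "'a set \<Rightarrow> ('a \<Rightarrow> 'a \<Rightarrow> bool) \<Rightarrow> bool" where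
  "weakly_modular V E \<longleftrightarrow> (\<forall>u\<in>V.
     (\<forall>v\<in>V. \<forall>w\<in>V. E v w \<and> 1 < dist E u v \<and> dist E u v = dist E u w \<longrightarrow>
        (\<exists>x. E x v \<and> E x w \<and> dist E u x = dist E u v - 1)) \<and>
     (\<forall>v\<in>V. \<forall>w\<in>V. \<forall>z\<in>V. E v z \<and> E w z \<and> dist E v w = 2 \<and> 2 \<le> dist E u v \<and>
        dist E u v = dist E u w \<and> dist E u z = dist E u v + 1 \<longrightarrow>
        (\<exists>x. E x v \<and> E x w \<and> dist E u x = dist E u v - 1)))"

definition locally_weakly_modular :: "'a set \<Rightarrow> ('a \<Rightarrow> 'a \<Rightarrow> bool) \<Rightarrow> bool" where
  "locally_weakly_modular V E \<longleftrightarrow> (\<forall>u\<in>V.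
     (\<forall>v\<in>V. \<forall>w\<in>V. E v w \<and> dist E u v = 2 \<and> dist E u w = 2 \<longrightarrow>
        (\<exists>x. E x u \<and> E x v \<and> E x w)) \<and>
     (\<forall>v\<in>V. \<forall>w\<in>V. \<forall>z\<in>V. E z v \<and> E z w \<and> dist E v w = 2 \<and> dist E u v = 2 \<and>
        dist E u w = 2 \<and> dist E u z = 3 \<longrightarrow>
        (\<exists>x. E x u \<and> E x v \<and> E x w)))"

definition K4m_V :: "nat set" where "K4m_V = {0, 1, 2, 3}"
definition K4m_E :: "nat \<Rightarrow> nat \<Rightarrow> bool" where
  "K4m_E i j \<longleftrightarrow> i \<in> K4m_V \<and> j \<in> K4m_V \<and> i \<noteq> j \<and> {i, j} \<noteq> {0, 3}"

definition K33m_V :: "nat set" where "K33m_V = {0, 1, 2, 3, 4, 5}"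
definition K33m_E :: "nat \<Rightarrow> nat \<Rightarrow> bool" where
  "K33m_E i j \<longleftrightarrow> i \<in> K33m_V \<and> j \<in> K33m_V \<and>
     ((i < 3 \<and> 3 \<le> j) \<or> (j < 3 \<and> 3 \<le> i)) \<and> {i, j} \<noteq> {0, 3}"

definition contains_induced ::
  "'a set \<Rightarrow> ('a \<Rightarrow> 'a \<Rightarrow> bool) \<Rightarrow> 'b set \<Rightarrow> ('b \<Rightarrow> 'b \<Rightarrow> bool) \<Rightarrow> bool" where
  "contains_induced V E V' E' \<longleftrightarrow> (\<exists>f. inj_on f V' \<and> f ` V' \<subseteq> V \<and>
     (\<forall>x\<in>V'. \<forall>y\<in>V'. E (f x) (f y) \<longleftrightarrow> E' x y))"

definition contains_isometric ::
  "'a set \<Rightarrow> ('a \<Rightarrow> 'a \<Rightarrow> bool) \<Rightarrow> 'b set \<Rightarrow> ('b \<Rightarrow> 'b \<Rightarrow> bool) \<Rightarrow> bool" where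
  "contains_isometric V E V' E' \<longleftrightarrow> (\<exists>f. inj_on f V' \<and> f ` V' \<subseteq> V \<and>
     (\<forall>x\<in>V'. \<forall>y\<in>V'. dist E (f x) (f y) = dist E' x y))"

section \<open>Simple connectivity of the triangle-square complex (edge-path group)\<close>

inductive tsc_move :: "('a \<Rightarrow> 'a \<Rightarrow> bool) \<Rightarrow> 'a list \<Rightarrow> 'a list \<Rightarrow> bool" for E where
  backtrack: "E a b \<Longrightarrow> tsc_move E (xs @ [a] @ ys) (xs @ [a, b, a] @ ys)"
| triangle: "E a b \<Longrightarrow> E b c \<Longrightarrow> E c a \<Longrightarrow>
     tsc_move E (xs @ [a] @ ys) (xs @ [a, b, c, a] @ ys)"
| square: "induced_4cycle E a b c e \<Longrightarrow>
     tsc_move E (xs @ [a] @ ys) (xs @ [a, b, c, e, a] @ ys)"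

definition tsc_simply_connected :: "('a \<Rightarrow> 'a \<Rightarrow> bool) \<Rightarrow> bool" where
  "tsc_simply_connected E \<longleftrightarrow>
     (\<forall>p. walk E p \<and> hd p = last p \<longrightarrow> equivclp (tsc_move E) p [hd p])"

end

theory Submission
  imports Defs
begin

text \<open>
  Write \<open>near u c v\<close> if \<open>v\<close> is adjacent to a point of the line (maximal clique) through \<open>u\<close> and \<open>c\<close>.
  In a thick weakly modular graph without \<open>K\<^sub>4\<^sup>-\<close> and isometric \<open>K\<^sub>3\<^sub>,\<^sub>3\<^sup>-\<close>, two vertices at distance 2 from \<open>u\<close>
  that are adjacent, or near two common lines through \<open>u\<close>, are near the same lines through \<open>u\<close>. Hence the
  vertices near the same lines as a fixed \<open>v\<close> with \<open>d(u,v) = 2\<close>, together with these lines, form a set of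
  diameter 2 that is closed under common neighbours, and weak modularity makes it gated. (A5) follows by
  induction on the distance, using gates in such sets. Conversely, the triangle and quadrangle conditions of
  a dual polar graph are read off the gates in maximal cliques and in hulls of pairs at distance 2.

  For the passage from local to global, the universal cover of the triangle-square complex is built ball by
  ball around a base point. A vertex of the next sphere is a neighbour \<open>z\<close> of some \<open>w\<close> in the last sphere that
  has no lift at \<open>w\<close> yet, where pairs \<open>(w, z)\<close> and \<open>(w', z)\<close> are identified if \<open>w\<close> and \<open>w'\<close> have a common lower
  neighbour; the local conditions make this relation transitive and the result weakly modular at the base
  point. Since triangles and squares lift to the cover, simple connectivity makes the covering map bijective.
\<close>

section \<open>Distances and gated sets\<close>

lemma walk_successively: "walk E p \<longleftrightarrow> p \<noteq> [] \<and> successively E p"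
  unfolding walk_def successively_conv_nth by auto

lemma walk_append:
  "p \<noteq> [] \<Longrightarrow> q \<noteq> [] \<Longrightarrow> walk E (p @ q) \<longleftrightarrow> walk E p \<and> walk E q \<and> E (last p) (hd q)"
  by (auto simp: walk_successively successively_append_iff)

lemma walk_sing [simp]: "walk E [x]"
  by (simp add: walk_successively)

lemma walk_Cons [simp]: "walk E (x # y # p) \<longleftrightarrow> E x y \<and> walk E (y # p)"
  by (simp add: walk_successively)

lemma not_walk_Nil [simp]: "\<not> walk E []"
  by (simp add: walk_def)

locale conn_graph =
  fixes V :: "'a set" and E :: "'a \<Rightarrow> 'a \<Rightarrow> bool"
  assumes graph: "graph V E"
begin

abbreviation d :: "'a \<Rightarrow> 'a \<Rightarrow> nat" where "d \<equiv> dist E"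

lemma E_V: "E u v \<Longrightarrow> u \<in> V \<and> v \<in> V"
  using graph unfolding graph_def by blast

lemma E_sym: "E u v \<Longrightarrow> E v u"
  using graph unfolding graph_def by blast

lemma E_irrefl [simp]: "\<not> E u u"
  using graph unfolding graph_def by blast

lemma dist_walk:
  assumes "u \<in> V" "v \<in> V"
  shows "\<exists>p. walk E p \<and> hd p = u \<and> last p = v \<and> length p = Suc (d u v)"
proof -
  obtain p where "walk E p" "hd p = u" "last p = v"
    using graph assms unfolding graph_def by blast
  moreover from this have "length p = Suc (length p - 1)"
    by (cases p) auto
  ultimately have "\<exists>n p. walk E p \<and> hd p = u \<and> last p = v \<and> length p = Suc n"
    by blast
  then show ?thesis unfolding dist_def by (rule LeastI_ex)
qed

lemma dist_le_walk: "walk E p \<Longrightarrow> d (hd p) (last p) \<le> length p - 1"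
  unfolding dist_def by (rule Least_le) (cases p; auto)

lemma d_self [simp]: "d u u = 0"
  using dist_le_walk[of "[u]"] by simp

lemma d_0_iff: "u \<in> V \<Longrightarrow> v \<in> V \<Longrightarrow> d u v = 0 \<longleftrightarrow> u = v"
  using dist_walk[of u v] by (fastforce simp: length_Suc_conv)

lemma d_le_sym: "u \<in> V \<Longrightarrow> v \<in> V \<Longrightarrow> d v u \<le> d u v"
proof -
  assume "u \<in> V" "v \<in> V"
  then obtain p where p: "walk E p" "hd p = u" "last p = v" "length p = Suc (d u v)"
    using dist_walk by blast
  have "successively E p" using p by (simp add: walk_successively)
  then have "successively (\<lambda>x y. E y x) p"
    by (rule successively_mono) (use E_sym in auto)
  then have "walk E (rev p)" using p by (auto simp: walk_successively)
  from dist_le_walk[OF this] p show ?thesis by (auto simp: hd_rev last_rev)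
qed

lemma d_sym: "u \<in> V \<Longrightarrow> v \<in> V \<Longrightarrow> d u v = d v u"
  using d_le_sym by (simp add: le_antisym)

lemma d_triangle:
  assumes "u \<in> V" "v \<in> V" "w \<in> V"
  shows "d u w \<le> d u v + d v w"
proof -
  obtain p where p: "walk E p" "hd p = u" "last p = v" "length p = Suc (d u v)"
    using dist_walk assms by blast
  obtain q where q: "walk E q" "hd q = v" "last q = w" "length q = Suc (d v w)"
    using dist_walk assms by blast
  show ?thesis
  proof (cases "tl q")
    case Nil
    then have "v = w" using q by (cases q) auto
    then show ?thesis by simp
  next
    case (Cons x r)
    then have q': "q = v # x # r" using q by (cases q) auto
    have "walk E (p @ x # r)"
      using p q q' by (cases "p = []") (auto simp: walk_append)
    from dist_le_walk[OF this] p q q' show ?thesis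
      by (cases "p = []") (auto)
  qed
qed

lemma d_1: "u \<in> V \<Longrightarrow> v \<in> V \<Longrightarrow> d u v = 1 \<Longrightarrow> E u v"
  using dist_walk[of u v] by (auto simp: length_Suc_conv)

lemma d_edge: "E u v \<Longrightarrow> d u v = 1"
  using dist_le_walk[of "[u,v]"] d_0_iff[of u v] E_V[of u v]
  by (cases "d u v = 0") auto

lemma d_nb: "u \<in> V \<Longrightarrow> E v w \<Longrightarrow> d u w \<le> Suc (d u v)"
  using d_triangle[of u v w] d_edge[of v w] E_V[of v w] by simp

lemma d_pred:
  assumes "u \<in> V" "v \<in> V" "d u v = Suc n"
  shows "\<exists>w. E w v \<and> d u w = n"
proof -
  obtain p where p: "walk E p" "hd p = u" "last p = v" "length p = Suc (Suc n)"
    using dist_walk assms by metis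
  then obtain q where q: "p = q @ [v]" "q \<noteq> []"
    by (cases p rule: rev_cases) (auto, metis length_0_conv nat.distinct(1))
  have e: "E (last q) v" "walk E q"
    using p q by (auto simp: walk_append)
  have "d u (last q) \<le> n" using dist_le_walk[OF e(2)] p q by auto
  moreover have "d u v \<le> Suc (d u (last q))" using d_nb[OF assms(1) e(1)] .
  ultimately show ?thesis using e assms by (metis Suc_le_mono le_antisym)
qed

lemma d_2_iff:
  "u \<in> V \<Longrightarrow> v \<in> V \<Longrightarrow> d u v = 2 \<longleftrightarrow> u \<noteq> v \<and> \<not> E u v \<and> (\<exists>w. E u w \<and> E w v)"
proof
  assume a: "u \<in> V" "v \<in> V" "d u v = 2"
  then obtain w where "E w v" "d u w = 1"
    using d_pred[of u v 1] by (auto simp: numeral_2_eq_2)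
  then show "u \<noteq> v \<and> \<not> E u v \<and> (\<exists>w. E u w \<and> E w v)"
    using a d_edge[of u v] d_1[of u w] E_V[of w v] E_sym by auto
next
  assume a: "u \<in> V" "v \<in> V" "u \<noteq> v \<and> \<not> E u v \<and> (\<exists>w. E u w \<and> E w v)"
  then obtain w where w: "E u w" "E w v" by blast
  have "d u v \<le> 2" using d_nb[OF a(1) w(2)] d_edge[OF w(1)] by simp
  moreover have "d u v \<noteq> 0" "d u v \<noteq> 1" using a d_0_iff[of u v] d_1[of u v] by auto
  ultimately show "d u v = 2" by simp
qed

lemma d_2I: "E u w \<Longrightarrow> E w v \<Longrightarrow> u \<noteq> v \<Longrightarrow> \<not> E u v \<Longrightarrow> d u v = 2"
  using d_2_iff[of u v] E_V[of u w] E_V[of w v] by blast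

lemma d_2E:
  assumes "d u v = 2" "u \<in> V" "v \<in> V"
  obtains w where "E u w" "E w v" "u \<noteq> v" "\<not> E u v"
  using assms d_2_iff by blast

lemma d_le_2_cases:
  assumes "u \<in> V" "v \<in> V" "d u v \<le> 2"
  obtains "u = v" | "E u v" | "d u v = 2"
  using assms d_0_iff[of u v] d_1[of u v] by (cases "d u v = 0"; cases "d u v = 1") auto

lemma d_path2: "E u w \<Longrightarrow> E w v \<Longrightarrow> d u v \<le> 2"
  using d_nb[of u w v] d_edge[of u w] E_V[of u w] by auto

lemma d_path3: "E u w \<Longrightarrow> E w x \<Longrightarrow> E x v \<Longrightarrow> d u v \<le> 3"
  using d_nb[of u x v] d_path2[of u w x] E_V[of u w] by auto

lemma interval_iff: "x \<in> interval V E u v \<longleftrightarrow> x \<in> V \<and> d u x + d x v = d u v"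
  by (simp add: interval_def)

lemma gated_subset: "gated V E H \<Longrightarrow> H \<subseteq> V"
  by (simp add: gated_def)

lemma gated_gate:
  assumes "gated V E H" "x \<in> V"
  obtains g where "g \<in> H" "\<And>y. y \<in> H \<Longrightarrow> d x y = d x g + d g y"
  using assms by (fastforce simp: gated_def interval_iff)

text \<open>Gated sets are convex: the detour through the gate \<open>g\<close> of \<open>z\<close>
  costs \<open>d z g\<close> towards both \<open>x\<close> and \<open>y\<close>, so a point
  \<open>z\<close> between them has \<open>d z g = 0\<close>.\<close>

lemma gated_convex:
  assumes H: "gated V E H" and "x \<in> H" "y \<in> H" "z \<in> V" "d x z + d z y = d x y"
  shows "z \<in> H"
proof -
  obtain g where g: "g \<in> H" "\<And>y. y \<in> H \<Longrightarrow> d z y = d z g + d g y"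
    using gated_gate[OF H assms(4)] by blast
  have V: "x \<in> V" "y \<in> V" "g \<in> V" using gated_subset[OF H] assms(2,3) g(1) by auto
  have "d x y \<le> d x g + d g y" using d_triangle V by blast
  moreover have "d x z = d z g + d x g" "d z y = d z g + d g y"
    using g(2)[OF assms(2)] g(2)[OF assms(3)] d_sym[OF V(1) assms(4)] d_sym[OF V(1) V(3)] by auto
  ultimately have "d z g = 0" using assms(5) by linarith
  then show ?thesis using d_0_iff[OF assms(4) V(3)] g(1) by auto
qed

lemma gated_common_nb:
  "gated V E H \<Longrightarrow> x \<in> H \<Longrightarrow> y \<in> H \<Longrightarrow> d x y = 2 \<Longrightarrow> E x z \<Longrightarrow> E z y \<Longrightarrow> z \<in> H"
  using gated_convex[of H x y z] d_edge[of x z] d_edge[of z y] E_V[of x z] by auto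

end

section \<open>Extending a partial cover by one sphere\<close>

locale lwm_graph = conn_graph V E for V :: "'a set" and E +
  fixes b :: 'a
  assumes b_V: "b \<in> V"
    and LTC: "u \<in> V \<Longrightarrow> E v w \<Longrightarrow> d u v = 2 \<Longrightarrow> d u w = 2 \<Longrightarrow> \<exists>x. E x u \<and> E x v \<and> E x w"
    and LQC: "u \<in> V \<Longrightarrow> E z v \<Longrightarrow> E z w \<Longrightarrow> d v w = 2 \<Longrightarrow> d u v = 2 \<Longrightarrow> d u w = 2 \<Longrightarrow> d u z = 3
      \<Longrightarrow> \<exists>x. E x u \<and> E x v \<and> E x w"

text \<open>
  The ball of radius \<open>N - 1\<close> of the cover: its vertices are lists, with \<open>hd\<close> as covering map, and a list of
  length \<open>n + 1\<close> lies at distance \<open>n\<close> from the base point \<open>[b]\<close>.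
\<close>

locale partial_cover = lwm_graph V E b for V :: "'a set" and E and b +
  fixes N :: nat and X :: "'a list set" and A :: "'a list \<Rightarrow> 'a list \<Rightarrow> bool"
  assumes N_pos: "1 \<le> N"
    and A_X: "A p q \<Longrightarrow> p \<in> X"
    and A_sym: "A p q \<Longrightarrow> A q p"
    and A_E: "A p q \<Longrightarrow> E (hd p) (hd q)"
    and A_len: "A p q \<Longrightarrow> length q \<le> Suc (length p)"
    and X_len: "p \<in> X \<Longrightarrow> 1 \<le> length p \<and> length p \<le> N"
    and X_V: "p \<in> X \<Longrightarrow> hd p \<in> V"
    and X_root: "[b] \<in> X" "p \<in> X \<Longrightarrow> length p = 1 \<Longrightarrow> p = [b]"
    and lower: "p \<in> X \<Longrightarrow> 1 < length p \<Longrightarrow> \<exists>q. A q p \<and> Suc (length q) = length p"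
    and TC: "A p q \<Longrightarrow> length p = length q \<Longrightarrow> \<exists>r. A r p \<and> A r q \<and> Suc (length r) = length p"
    and QC: "A p z \<Longrightarrow> A q z \<Longrightarrow> Suc (length p) = length z \<Longrightarrow> Suc (length q) = length z
      \<Longrightarrow> p = q \<or> (\<exists>r. A r p \<and> A r q \<and> Suc (length r) = length p)"
    and star: "p \<in> X \<Longrightarrow> length p < N \<Longrightarrow> E (hd p) a \<Longrightarrow> \<exists>q. A p q \<and> hd q = a"
    and inj: "A p q \<Longrightarrow> A p r \<Longrightarrow> hd q = hd r \<Longrightarrow> q = r"
    and adj: "A p q \<Longrightarrow> A p r \<Longrightarrow> E (hd q) (hd r) \<Longrightarrow> A q r"
    and quad: "A p q \<Longrightarrow> A q c \<Longrightarrow> A p e \<Longrightarrow> E (hd c) (hd e) \<Longrightarrow> length p < N \<Longrightarrow> length q < N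
      \<Longrightarrow> A c e"
begin

lemma A_X2: "A p q \<Longrightarrow> q \<in> X"
  using A_X A_sym by blast

lemma A_len': "A p q \<Longrightarrow> length p \<le> N \<and> length p \<le> Suc (length q) \<and> length q \<le> N"
  using A_X A_X2 X_len A_len A_sym by blast

text \<open>At the middle vertex \<open>q\<close>, \<open>inj\<close> and \<open>adj\<close> turn a
  coincidence or an edge between the projections into one in the cover, which the lengths forbid.
  This supplies the distances 2 that the local conditions ask for.\<close>

lemma dist_up2:
  assumes "A p q" "A q r" "length r = Suc (Suc (length p))"
  shows "d (hd p) (hd r) = 2"
proof (rule d_2I)
  have l: "length p < N" "length q < N" using A_len'[OF assms(2)] A_len'[OF assms(1)] assms A_len[OF assms(2)] A_len[OF assms(1)] by auto
  show "E (hd p) (hd q)" "E (hd q) (hd r)" using assms A_E by auto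
  show "hd p \<noteq> hd r"
  proof
    assume "hd p = hd r"
    then have "p = r" using inj[OF A_sym[OF assms(1)] assms(2)] by simp
    then show False using assms by simp
  qed
  show "\<not> E (hd p) (hd r)"
  proof
    assume "E (hd p) (hd r)"
    then have "A p r" using adj[OF A_sym[OF assms(1)] assms(2)] by blast
    then show False using A_len assms(3) by fastforce
  qed
qed

section \<open>New vertices over the last sphere\<close>

definition free :: "'a list \<Rightarrow> 'a \<Rightarrow> bool" where
  "free w z \<longleftrightarrow> w \<in> X \<and> length w = N \<and> E (hd w) z \<and> \<not> (\<exists>q. A w q \<and> hd q = z)"

text \<open>The equality disjunct makes \<open>com\<close> reflexive also for \<open>N = 1\<close>,
  where the only vertex is the root and has no lower neighbour.\<close>

definition com :: "'a list \<Rightarrow> 'a list \<Rightarrow> bool" where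
  "com w w' \<longleftrightarrow> w = w' \<or> (\<exists>u. A u w \<and> A u w' \<and> Suc (length u) = N)"

lemma com_refl [simp]: "com w w"
  by (simp add: com_def)

lemma com_sym: "com w w' \<Longrightarrow> com w' w"
  by (auto simp: com_def)

text \<open>This transitivity is the only place where the local quadrangle condition is needed.\<close>

lemma com_trans:
  assumes Z: "free w z" "free w' z" "free w'' z" and c: "com w w'" "com w' w''"
  shows "com w w''"
proof (cases "w = w' \<or> w' = w''")
  case True
  then show ?thesis using c by auto
next
  case False
  have L: "length w = N" "length w' = N" "length w'' = N" using Z free_def by auto
  obtain u where u: "A u w" "A u w'" "Suc (length u) = N" using c(1) False com_def by auto
  obtain u' where u': "A u' w'" "A u' w''" "Suc (length u') = N" using c(2) False com_def by auto
  show ?thesis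
  proof (cases "u = u'")
    case True
    then show ?thesis using u u' com_def by auto
  next
    case False
    \<comment> \<open>\<open>x\<close> lies two levels below \<open>w\<close>, \<open>w'\<close> and
      \<open>w''\<close>; the local conditions are applied at its projection.\<close>
    then obtain x where x: "A x u" "A x u'" "Suc (length x) = length u"
      using QC[of u w' u'] u u' L by auto
    have xX: "x \<in> X" and xV: "hd x \<in> V" using A_X x X_V by auto
    have dx: "d (hd x) (hd w) = 2" "d (hd x) (hd w') = 2" "d (hd x) (hd w'') = 2"
      using dist_up2[OF x(1) u(1)] dist_up2[OF x(1) u(2)] dist_up2[OF x(2) u'(2)] u u' x L by auto
    have zE: "E (hd w) z" "E (hd w') z" "E (hd w'') z" using Z free_def by auto
    have zV: "z \<in> V" using E_V[OF zE(1)] by blast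
    have Q: "A v t" if "A x s" "A s v" "A x t" "E (hd v) (hd t)" "Suc (length s) = N" for s v t
      using quad[OF that(1,2,3,4)] that(5) A_len'[OF that(1)] u(3) x(3) by simp
    \<comment> \<open>\<open>LQC\<close> needs the exact distance. A shorter connection from
      \<open>hd x\<close> to \<open>z\<close> would lift and produce a lift of \<open>z\<close> at
      \<open>w'\<close>, against \<open>free w' z\<close>.\<close>
    have d3: "d (hd x) z = 3"
    proof -
      have 1: "d (hd x) z \<le> 3"
        using d_path3[OF A_E[OF x(1)] A_E[OF u(2)] zE(2)] .
      have 2: "\<not> E (hd x) z"
      proof
        assume "E (hd x) z"
        then obtain t where t: "A x t" "hd t = z" using star xX x u(3) by fastforce
        then have "A w' t" using Q[OF x(1) u(2)] zE u(3) by auto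
        then show False using t Z(2) free_def by auto
      qed
      have 3: "d (hd x) z \<noteq> 2"
      proof
        assume "d (hd x) z = 2"
        then obtain a where a: "E a (hd x)" "E a (hd w')" "E a z"
          using LTC[OF xV zE(2) dx(2)] by blast
        then obtain t where t: "A x t" "hd t = a" using star[OF xX _ E_sym] x u(3) by fastforce
        then have wt: "A w' t" using Q[OF x(1) u(2)] a E_sym u(3) by auto
        have "length t < N" using A_len[OF t(1)] x u(3) by simp
        then obtain s where s: "A t s" "hd s = z" using star[of t z] t a A_X2 by blast
        then have "A w' s" using adj[OF A_sym[OF wt] s(1)] zE by simp
        then show False using s Z(2) free_def by auto
      qed
      have 4: "hd x \<noteq> z" using zE(2) dx(2) d_edge[OF E_sym[OF zE(2)]] by auto
      show ?thesis using 1 2 3 4 d_le_2_cases[OF xV zV] by (cases "d (hd x) z \<le> 2") auto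
    qed
    \<comment> \<open>Such an \<open>a\<close> lifts at \<open>x\<close> to a common lower neighbour
      of \<open>w\<close> and \<open>w''\<close>.\<close>
    have fin: ?thesis if f: "E a (hd x)" "E a (hd w)" "E a (hd w'')" for a
    proof -
      obtain t where t: "A x t" "hd t = a" using star[OF xX _ E_sym[OF f(1)]] x u(3) by fastforce
      have 1: "A w t" "A w'' t" using Q[OF x(1) u(1) t(1)] Q[OF x(2) u'(2) t(1)] t f E_sym u u' by auto
      have "Suc (length t) = N" using A_len[OF t(1)] A_len'[OF 1(1)] x u(3) L by simp
      then show ?thesis using 1 A_sym com_def by blast
    qed
    have wV: "hd w \<in> V" "hd w'' \<in> V" using Z X_V free_def by auto
    have dw: "d (hd w) (hd w'') \<le> 2" using d_path2 zE E_sym by blast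
    show ?thesis
    proof (cases rule: d_le_2_cases[OF wV dw])
      case 1
      have "E (hd w) (hd u')" using E_sym[OF A_E[OF u'(2)]] 1 by simp
      then have "A w u'" using Q[OF x(1) u(1) x(2)] u(3) by blast
      then have "w = w''" using inj[OF A_sym u'(2)] 1 by blast
      then show ?thesis by simp
    next
      case 2
      then show ?thesis using LTC[OF xV 2 dx(1) dx(3)] fin by blast
    next
      case 3
      then show ?thesis using LQC[OF xV E_sym[OF zE(1)] E_sym[OF zE(3)] 3 dx(1) dx(3) d3] fin by blast
    qed
  qed
qed

definition rep :: "'a list \<Rightarrow> 'a \<Rightarrow> 'a list" where
  "rep w z = (SOME w'. free w' z \<and> com w w')"

lemma rep: "free w z \<Longrightarrow> free (rep w z) z \<and> com w (rep w z)"
  unfolding rep_def by (rule someI[where x=w]) auto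

text \<open>Transitivity of \<open>com\<close> makes the predicates under the two choices coincide,
  so \<open>rep w z\<close> depends only on the class of \<open>(w, z)\<close>.\<close>

lemma rep_eq: "free w z \<Longrightarrow> free w' z \<Longrightarrow> com w w' \<Longrightarrow> rep w z = rep w' z"
proof -
  assume "free w z" "free w' z" "com w w'"
  then have "free x z \<and> com w x \<longleftrightarrow> free x z \<and> com w' x" for x
    using com_trans[of w z w' x] com_trans[of w' z w x] com_sym[of w w'] by blast
  then show ?thesis unfolding rep_def by simp
qed

text \<open>The new vertex given by the class of \<open>(w, z)\<close> is the list \<open>z # rep w z\<close>.\<close>

definition up :: "'a list \<Rightarrow> 'a list \<Rightarrow> bool" where
  "up w q \<longleftrightarrow> (\<exists>z. free w z \<and> q = z # rep w z)"

lemma upD: "up w q \<Longrightarrow> w \<in> X \<and> length w = N \<and> length q = Suc N \<and> E (hd w) (hd q) \<and> free w (hd q)"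
  using rep by (auto simp: up_def free_def)

text \<open>The tail of \<open>q\<close> is the representative of both classes, and
  \<open>com\<close> passes through it.\<close>

lemma up_com: "up w q \<Longrightarrow> up w' q \<Longrightarrow> com w w'"
proof -
  assume "up w q" "up w' q"
  then obtain z where z: "free w z" "free w' z" "rep w z = rep w' z" unfolding up_def by auto
  then show ?thesis
    using com_trans[of w z "rep w z" w'] rep[of w z] rep[of w' z] com_sym[of w' "rep w' z"] by simp
qed

lemma com_up: "up w q \<Longrightarrow> free w' (hd q) \<Longrightarrow> com w w' \<Longrightarrow> up w' q"
proof -
  assume a: "up w q" "free w' (hd q)" "com w w'"
  then obtain z where "free w z" "q = z # rep w z" unfolding up_def by auto
  then show ?thesis using a rep_eq[of w z w'] unfolding up_def by auto
qed

lemma free_up: "free w z \<Longrightarrow> \<exists>q. up w q \<and> hd q = z"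
  unfolding up_def by auto

lemma up_inj: "up w q \<Longrightarrow> up w q' \<Longrightarrow> hd q = hd q' \<Longrightarrow> q = q'"
  unfolding up_def by auto

section \<open>Adjacency in the enlarged ball\<close>

definition hor :: "'a list \<Rightarrow> 'a list \<Rightarrow> bool" where
  "hor p q \<longleftrightarrow> (\<exists>w. up w p \<and> up w q \<and> E (hd p) (hd q))"

definition X' :: "'a list set" where "X' = X \<union> {q. \<exists>w. up w q}"

definition A' :: "'a list \<Rightarrow> 'a list \<Rightarrow> bool" where
  "A' p q \<longleftrightarrow> A p q \<or> up p q \<or> up q p \<or> hor p q"

lemma A'I: "A p q \<Longrightarrow> A' p q" "up p q \<Longrightarrow> A' p q" "up q p \<Longrightarrow> A' p q" "hor p q \<Longrightarrow> A' p q"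
  by (auto simp: A'_def)

lemma A'_sym: "A' p q \<Longrightarrow> A' q p"
  unfolding A'_def hor_def using A_sym E_sym by blast

lemma A'_E: "A' p q \<Longrightarrow> E (hd p) (hd q)"
  unfolding A'_def hor_def using A_E E_sym upD by blast

lemma up_len: "up w q \<Longrightarrow> length w = N \<and> length q = Suc N"
  using upD by blast

lemma hor_len: "hor p q \<Longrightarrow> length p = Suc N \<and> length q = Suc N"
  unfolding hor_def using upD by blast

text \<open>In this and the next four lemmas, the levels of the two ends decide which kinds of
  adjacency are possible.\<close>

lemma A'_lt: "length p < N \<Longrightarrow> A' p q \<longleftrightarrow> A p q"
  unfolding A'_def using up_len[of p q] up_len[of q p] hor_len[of p q] A_len'[of p q] A_len[of p q] by auto

lemma A'_le: "length p \<le> N \<Longrightarrow> length q \<le> N \<Longrightarrow> A' p q \<longleftrightarrow> A p q"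
  unfolding A'_def using up_len[of p q] up_len[of q p] hor_len[of p q] A_len'[of p q] A_len[of p q] by auto

lemma A'_up: "length p = N \<Longrightarrow> length q = Suc N \<Longrightarrow> A' p q \<longleftrightarrow> up p q"
  unfolding A'_def using up_len[of p q] up_len[of q p] hor_len[of p q] A_len'[of p q] A_len[of p q] by auto

lemma A'_hor: "length p = Suc N \<Longrightarrow> length q = Suc N \<Longrightarrow> A' p q \<longleftrightarrow> hor p q"
  unfolding A'_def using up_len[of p q] up_len[of q p] hor_len[of p q] A_len'[of p q] A_len[of p q] by auto

lemma A'_len: "A' p q \<Longrightarrow> length p \<le> Suc N \<and> length q \<le> Suc N \<and> length q \<le> Suc (length p) \<and> length p \<le> Suc (length q)"
  unfolding A'_def using up_len[of p q] up_len[of q p] hor_len[of p q] A_len'[of p q] A_len[of p q] by auto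

text \<open>By \<open>adj\<close> at \<open>r\<close>, a lift of \<open>z\<close> at
  \<open>r\<close> would be adjacent to \<open>p\<close> and hence a lift of \<open>z\<close> at
  \<open>p\<close>.\<close>

lemma free_propagate:
  assumes "A p r" "length r = N" "free p z" "E (hd r) z"
  shows "free r z"
proof -
  have "z \<noteq> hd q" if "A r q" for q
    using adj[OF A_sym[OF assms(1)] that] assms unfolding free_def by auto
  then show ?thesis using assms A_X2 unfolding free_def by blast
qed

lemma com_TC: "A p r \<Longrightarrow> length p = N \<Longrightarrow> length r = N \<Longrightarrow> com p r"
  using TC unfolding com_def by fastforce

text \<open>An old and a new neighbour of \<open>p\<close> cannot have the same projection, since
  new vertices are only created for projections that are free at \<open>p\<close>.\<close>

lemma A'_inj_le:
  assumes "length p \<le> N" "A' p q" "A' p r" "hd q = hd r"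
  shows "q = r"
proof (cases "length p < N")
  case True
  then show ?thesis using assms A'_lt inj by blast
next
  case False
  then have l: "length p = N" using assms by simp
  consider "length q \<le> N" "length r \<le> N" | "length q = Suc N" "length r \<le> N"
    | "length q \<le> N" "length r = Suc N" | "length q = Suc N" "length r = Suc N"
    using A'_len[OF assms(2)] A'_len[OF assms(3)] by linarith
  then show ?thesis
  proof cases
    case 1
    then have "A p q" "A p r" using assms l A'_le by auto
    then show ?thesis using inj assms(4) by blast
  next
    case 2
    then have "up p q" "A p r" using assms l A'_up A'_le by auto
    then show ?thesis using upD free_def assms by metis
  next
    case 3
    then have "up p r" "A p q" using assms l A'_up A'_le by auto
    then show ?thesis using upD free_def assms by metis
  next
    case 4
    then have "up p r" "up p q" using assms l A'_up by auto
    then show ?thesis using up_inj assms by blast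
  qed
qed

text \<open>If \<open>r\<close> is in the last sphere, \<open>hd q\<close> is free there too and
  gives the same class, so \<open>q\<close> also lies over \<open>r\<close>. If \<open>r\<close> is
  lower, \<open>hd q\<close> already has a lift at \<open>r\<close>, which \<open>adj\<close> would
  make a lift at \<open>p\<close>.\<close>

lemma A'_adj_up:
  assumes "up p q" "A p r" "E (hd q) (hd r)"
  shows "A' q r"
proof (cases "length r = N")
  case True
  have "free r (hd q)" using free_propagate[OF assms(2) True] upD[OF assms(1)] E_sym[OF assms(3)] by blast
  moreover have "com p r" using com_TC assms upD True by blast
  ultimately have "up r q" using com_up assms by blast
  then show ?thesis by (rule A'I)
next
  case False
  have p: "length p = N" "free p (hd q)" using upD[OF assms(1)] by auto
  then have "length r < N" using False A_len'[OF assms(2)] by auto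
  then obtain s where s: "A r s" "hd s = hd q"
    using star[of r "hd q"] A_X2[OF assms(2)] E_sym[OF assms(3)] by blast
  have "A p s" using adj[OF A_sym[OF assms(2)] s(1)] s(2) upD[OF assms(1)] by auto
  then show ?thesis using p s free_def by auto
qed

lemma A'_adj_le:
  assumes "length p \<le> N" "A' p q" "A' p r" "E (hd q) (hd r)"
  shows "A' q r"
proof (cases "length p < N")
  case True
  then show ?thesis using assms A'_lt adj A'I(1) by blast
next
  case False
  then have l: "length p = N" using assms by simp
  consider "length q \<le> N" "length r \<le> N" | "length q = Suc N" "length r \<le> N"
    | "length q \<le> N" "length r = Suc N" | "length q = Suc N" "length r = Suc N"
    using A'_len[OF assms(2)] A'_len[OF assms(3)] by linarith
  then show ?thesis
  proof cases
    case 1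
    then have "A p q" "A p r" using assms l A'_le by auto
    then show ?thesis using adj assms(4) A'I(1) by blast
  next
    case 2
    then have "up p q" "A p r" using assms l A'_up A'_le by auto
    then show ?thesis using A'_adj_up assms by blast
  next
    case 3
    then have "up p r" "A p q" using assms l A'_up A'_le by auto
    then show ?thesis using A'_adj_up A'_sym E_sym assms by blast
  next
    case 4
    then have "up p r" "up p q" using assms l A'_up by auto
    then show ?thesis using A'I(4) assms unfolding hor_def by blast
  qed
qed

lemma A'_star:
  assumes "p \<in> X" "E (hd p) z"
  shows "\<exists>q. A' p q \<and> hd q = z"
proof (cases "length p < N")
  case True
  then show ?thesis using star assms A'I(1) by blast
next
  case False
  then have l: "length p = N" using X_len[OF assms(1)] by simp
  show ?thesis
  proof (cases "free p z")
    case True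
    then show ?thesis using free_up A'I(2) by blast
  next
    case False
    then show ?thesis using l assms A'I(1) unfolding free_def by blast
  qed
qed

section \<open>Lifting squares to the enlarged ball\<close>

lemma quad_up_le:
  assumes "A p q" "Suc (length p) = N" "length q = N"
    and "A q c" "A p e" "E (hd c) (hd e)"
  shows "A c e"
proof -
  have le: "length e \<le> N" "length c \<le> N" using A_len' assms by auto
  have eX: "e \<in> X" using A_X2 assms by blast
  consider (e_low) "length e < N" | (c_low) "length e = N" "length c < N"
    | (both) "length e = N" "length c = N"
    using le by linarith
  then show ?thesis
  proof cases
    case e_low
    then obtain s where s: "A e s" "hd s = hd c" using star[OF eX e_low] assms E_sym by blast
    have "A s q" using quad[OF assms(5) s(1) assms(1)] s e_low assms A_E E_sym by auto
    then have "s = c" using inj[OF A_sym assms(4)] s by blast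
    then show ?thesis using s A_sym by blast
  next
    case c_low
    have "Suc (length c) = length q" using A_len'[OF assms(4)] c_low assms by linarith
    then consider "p = c" | x where "A x p" "A x c" "Suc (length x) = length p"
      using QC[OF assms(1) A_sym[OF assms(4)]] assms by auto
    then show ?thesis
    proof cases
      case 1
      then show ?thesis using assms by simp
    next
      case 2
      have "A e c" using quad[OF 2(1) assms(5) 2(2)] 2 assms E_sym by auto
      then show ?thesis by (rule A_sym)
    qed
  next
    \<comment> \<open>Descending by \<open>TC\<close> and then \<open>QC\<close> leads to a vertex
      \<open>s\<close> two levels below \<open>c\<close> and \<open>e\<close>; the common neighbour
      given by \<open>LTC\<close> lifts at \<open>s\<close> to a vertex \<open>t\<close> adjacent to
      both, and \<open>adj\<close> at \<open>t\<close> closes the square.\<close>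
    case both
    then obtain x where x: "A x q" "A x c" "Suc (length x) = N" using TC[OF assms(4)] assms by auto
    then consider "x = p" | s where "A s x" "A s p" "Suc (length s) = length x"
      using QC[OF x(1) assms(1)] assms by auto
    then show ?thesis
    proof cases
      case 1
      then show ?thesis using adj x assms by blast
    next
      case 2
      have sX: "s \<in> X" "hd s \<in> V" using 2 A_X X_V by auto
      have "d (hd s) (hd c) = 2" "d (hd s) (hd e) = 2"
        using dist_up2[OF 2(1) x(2)] dist_up2[OF 2(2) assms(5)] both x 2 assms by auto
      then obtain a where a: "E a (hd s)" "E a (hd c)" "E a (hd e)"
        using LTC[OF sX(2) assms(6)] by blast
      then obtain t where t: "A s t" "hd t = a" using star[OF sX(1) _ E_sym[OF a(1)]] 2 x by fastforce
      have "A e t" using quad[OF 2(2) assms(5) t(1)] t a E_sym 2 x assms by auto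
      moreover have "A c t" using quad[OF 2(1) x(2) t(1)] t a E_sym 2 x assms by auto
      ultimately show ?thesis using adj A_sym assms by blast
    qed
  qed
qed

text \<open>When \<open>c\<close> is new, a lift of \<open>hd c\<close> at \<open>e\<close> would be
  adjacent to \<open>q\<close> and contradict freeness at \<open>q\<close>. So \<open>e\<close> is
  not lower than \<open>q\<close>, and if it is in the last sphere it belongs to the class of
  \<open>q\<close> through \<open>p\<close>.\<close>

lemma quad_up:
  assumes "A p q" "Suc (length p) = N" "length q = N"
    and "A' q c" "A p e" "E (hd c) (hd e)"
  shows "A' c e"
proof (cases "length c \<le> N")
  case True
  then have "A q c" using A'_le assms by auto
  then show ?thesis using quad_up_le assms A'I(1) by blast
next
  case False
  then have c: "length c = Suc N" using A'_len[OF assms(4)] by simp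
  then have up: "up q c" using A'_up assms by blast
  show ?thesis
  proof (cases "length e = N")
    case True
    have "free e (hd c)"
    proof -
      have "hd s \<noteq> hd c" if s: "A e s" for s
      proof
        assume h: "hd s = hd c"
        have "A s q" using quad_up_le[OF assms(5,2) True s assms(1)] h upD[OF up] E_sym by simp
        then show False using upD[OF up] h A_sym free_def by metis
      qed
      then show ?thesis using True A_X2 assms E_sym unfolding free_def by blast
    qed
    moreover have "com q e" using assms unfolding com_def by blast
    ultimately have "up e c" using com_up up by blast
    then show ?thesis by (rule A'I)
  next
    case False
    then have l: "length e < N" using A_len'[OF assms(5)] by simp
    then obtain s where s: "A e s" "hd s = hd c" using star[OF A_X2[OF assms(5)] l] assms E_sym by blast
    have "A s q" using quad[OF assms(5) s(1) assms(1)] s l assms A'_E[OF assms(4)] E_sym by auto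
    then show ?thesis using upD[OF up] s A_sym free_def by metis
  qed
qed

lemma A'_quad:
  assumes "A' p q" "A' q c" "A' p e" "E (hd c) (hd e)" "length p \<le> N" "length q \<le> N"
  shows "A' c e"
proof -
  have Apq: "A p q" using assms A'_le by blast
  have lq: "length q \<le> Suc (length p)" "length p \<le> Suc (length q)" using A_len[OF Apq] A_len'[OF Apq] by auto
  consider (low) "length p < N" "length q < N" | (pq) "Suc (length p) = N" "length q = N"
    | (qp) "Suc (length q) = N" "length p = N" | (eq) "length p = N" "length q = N"
    using assms(5,6) lq by linarith
  then show ?thesis
  proof cases
    case low
    then show ?thesis using quad[of p q c e] assms A'_lt A'I Apq by metis
  next
    case pq
    then show ?thesis using quad_up[OF Apq pq assms(2) _ assms(4)] assms A'_lt by auto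
  next
    case qp
    then have "A' e c" using quad_up[OF A_sym[OF Apq] qp assms(3) _ E_sym[OF assms(4)]] assms A'_lt by auto
    then show ?thesis by (rule A'_sym)
  next
    \<comment> \<open>\<open>TC\<close> gives \<open>x\<close> below the horizontal edge
      \<open>p q\<close>. If \<open>x\<close> sees \<open>c\<close> or \<open>e\<close>,
      \<open>quad_up\<close> applies directly; otherwise \<open>LTC\<close> at \<open>hd x\<close>
      yields a vertex whose lift at \<open>x\<close> is adjacent to both.\<close>
    case eq
    then obtain x where x: "A x p" "A x q" "Suc (length x) = N" using TC[OF Apq] by auto
    have xX: "x \<in> X" and xV: "hd x \<in> V" using x A_X X_V by auto
    have x': "A' p x" "A' q x" using x A_sym A'I by auto
    have eV: "hd e \<in> V" "hd c \<in> V" using E_V[OF assms(4)] by auto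
    have dle: "d (hd x) (hd e) \<le> 2" "d (hd x) (hd c) \<le> 2"
      using d_path2 A'_E assms x A_E by blast+
    have e_case: ?thesis if "E (hd x) (hd e)"
    proof -
      have "A' x e" using A'_adj_le[OF _ x'(1) assms(3) that] assms by blast
      then have "A x e" using A'_lt x by auto
      then show ?thesis using quad_up[OF x(2,3) eq(2) assms(2) _ assms(4)] by blast
    qed
    have c_case: ?thesis if "E (hd x) (hd c)"
    proof -
      have "A' x c" using A'_adj_le[OF _ x'(2) assms(2) that] assms by blast
      then have "A x c" using A'_lt x by auto
      then have "A' e c" using quad_up[OF x(1,3) eq(1) assms(3) _ E_sym[OF assms(4)]] by blast
      then show ?thesis by (rule A'_sym)
    qed
    show ?thesis
    proof (cases rule: d_le_2_cases[OF xV eV(1) dle(1)])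
      case 1
      then show ?thesis using c_case assms(4) E_sym by simp
    next
      case 2
      then show ?thesis by (rule e_case)
    next
      case e2: 3
      show ?thesis
      proof (cases rule: d_le_2_cases[OF xV eV(2) dle(2)])
        case 1
        then show ?thesis using e_case assms(4) by simp
      next
        case 2
        then show ?thesis by (rule c_case)
      next
        case 3
        then obtain a where a: "E a (hd x)" "E a (hd c)" "E a (hd e)"
          using LTC[OF xV assms(4) 3 e2] by blast
        then obtain t where t: "A x t" "hd t = a" using star[OF xX _ E_sym[OF a(1)]] x by fastforce
        have "A' e t" using quad_up[OF x(1,3) eq(1) assms(3) t(1)] t a E_sym by auto
        moreover have "A' c t" using quad_up[OF x(2,3) eq(2) assms(2) t(1)] t a E_sym by auto
        moreover have "length t \<le> N" using A_len' t by blast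
        ultimately show ?thesis using A'_adj_le A'_sym assms(4) by blast
      qed
    qed
  qed
qed

section \<open>Injectivity and triangles around new vertices\<close>

lemma A'_inj:
  assumes "A' p q" "A' p r" "hd q = hd r"
  shows "q = r"
proof (cases "length p \<le> N")
  case True
  then show ?thesis using A'_inj_le assms by blast
next
  case False
  then have p: "length p = Suc N" using A'_len[OF assms(1)] by simp
  \<comment> \<open>A lower and a horizontal neighbour of \<open>p\<close> cannot have the same
    projection: with \<open>r\<close> over \<open>y\<close>, either \<open>y = q\<close> gives a
    loop, or \<open>y\<close> is adjacent to \<open>q\<close> and \<open>hd r\<close> is not free at
    \<open>y\<close>.\<close>
  have mixed: False if a: "A' p q" "A' p r" "hd q = hd r" "length q = N" "length r = Suc N" for q r
  proof -
    have u: "up q p" using that p A'_sym A'_up by blast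
    obtain y where y: "up y p" "up y r" using a(2,5) p A'_hor unfolding hor_def by blast
    have Eyq: "E (hd y) (hd q)" using upD[OF y(2)] that by simp
    consider "y = q" | v where "A v y" "A v q" using up_com[OF y(1) u] unfolding com_def by blast
    then show False
    proof cases
      case 1
      then show ?thesis using Eyq by simp
    next
      case 2
      then have "A y q" using adj Eyq by blast
      then show ?thesis using upD[OF y(2)] that free_def by auto
    qed
  qed
  consider "length q = N" "length r = N" | "length q = N" "length r = Suc N"
    | "length r = N" "length q = Suc N" | "length q = Suc N" "length r = Suc N"
    using A'_len[OF assms(1)] A'_len[OF assms(2)] p by linarith
  then show ?thesis
  proof cases
    case 1
    then have "com q r" using up_com assms p A'_sym A'_up by blast
    then show ?thesis using inj assms unfolding com_def by blast
  next
    case 2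
    then show ?thesis using mixed assms by blast
  next
    case 3
    then show ?thesis using mixed[OF assms(2,1)] assms by simp
  next
    case 4
    obtain y where y: "up y p" "up y q" using assms(1) p 4 A'_hor unfolding hor_def by blast
    obtain y' where y': "up y' p" "up y' r" using assms(2) p 4 A'_hor unfolding hor_def by blast
    \<comment> \<open>The class of \<open>q\<close> can be moved from \<open>y\<close> to
      \<open>y'\<close>, and over one \<open>y'\<close> the projection determines the new
      vertex.\<close>
    have "up y' q" using com_up[OF y(2)] up_com[OF y(1) y'(1)] upD[OF y'(2)] assms(3) by simp
    then show ?thesis using up_inj y' assms by blast
  qed
qed

lemma A'_adj:
  assumes "A' p q" "A' p r" "E (hd q) (hd r)"
  shows "A' q r"
proof (cases "length p \<le> N")
  case True
  then show ?thesis using A'_adj_le assms by blast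
next
  case False
  then have p: "length p = Suc N" using A'_len[OF assms(1)] by simp
  \<comment> \<open>An old lift of \<open>hd r\<close> at \<open>q\<close> would be adjacent to
    \<open>p\<close> and hence equal to \<open>r\<close> by \<open>A'_inj\<close>, although it has a
    smaller length. So \<open>hd r\<close> is free at \<open>q\<close>, and \<open>r\<close> lies
    over \<open>q\<close> as well.\<close>
  have mixed: "A' q r" if a: "A' p q" "A' p r" "E (hd q) (hd r)" "length q = N" "length r = Suc N" for q r
  proof -
    have u: "up q p" using that p A'_sym A'_up by blast
    obtain y where y: "up y p" "up y r" using a(2,5) p A'_hor unfolding hor_def by blast
    have "hd s \<noteq> hd r" if s: "A q s" for s
    proof
      assume h: "hd s = hd r"
      have "A' p s" using A'_adj_le[of q p s] a(4) A'_sym[OF a(1)] A'I(1)[OF s] A'_E[OF a(2)] h by simp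
      then have "s = r" using A'_inj a(2) h by blast
      then show False using a(5) A_len'[OF s] by simp
    qed
    then have "free q (hd r)" using upD[OF u] a unfolding free_def by blast
    then have "up q r" using com_up[OF y(2)] up_com[OF y(1) u] by blast
    then show ?thesis by (rule A'I)
  qed
  consider "length q = N" "length r = N" | "length q = N" "length r = Suc N"
    | "length r = N" "length q = Suc N" | "length q = Suc N" "length r = Suc N"
    using A'_len[OF assms(1)] A'_len[OF assms(2)] p by linarith
  then show ?thesis
  proof cases
    case 1
    then have "com q r" using up_com assms p A'_sym A'_up by blast
    then show ?thesis using adj assms A'I(1) E_irrefl unfolding com_def by metis
  next
    case 2
    then show ?thesis using mixed assms by blast
  next
    case 3
    then show ?thesis using mixed[OF assms(2,1)] assms E_sym A'_sym by blast
  next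
    case 4
    obtain y where y: "up y p" "up y q" using assms(1) p 4 A'_hor unfolding hor_def by blast
    obtain y' where y': "up y' p" "up y' r" using assms(2) p 4 A'_hor unfolding hor_def by blast
    consider "y = y'" | u where "A u y" "A u y'" "Suc (length u) = N"
      using up_com[OF y(1) y'(1)] unfolding com_def by blast
    then show ?thesis
    proof cases
      case 1
      then show ?thesis using y y' assms A'I(4) unfolding hor_def by blast
    next
      case 2
      have uX: "u \<in> X" and uV: "hd u \<in> V" using 2 A_X X_V by auto
      \<comment> \<open>\<open>u\<close> is two levels below \<open>q\<close> and \<open>r\<close>,
        so \<open>LTC\<close> at \<open>hd u\<close> will give a vertex whose lift at
        \<open>u\<close> is adjacent to both.\<close>
      have dist2: "d (hd u) (hd s) = 2" if "A u v" "up v s" for v s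
      proof (rule d_2I)
        have f: "free v (hd s)" using upD[OF that(2)] by blast
        show "E (hd u) (hd v)" "E (hd v) (hd s)" using that A_E upD by auto
        show "hd u \<noteq> hd s" using f A_sym[OF that(1)] unfolding free_def by auto
        show "\<not> E (hd u) (hd s)"
        proof
          assume "E (hd u) (hd s)"
          then obtain t where t: "A u t" "hd t = hd s" using star[OF uX] 2 by fastforce
          have "A v t" using adj[OF that(1) t(1)] t upD[OF that(2)] by simp
          then show False using f t unfolding free_def by auto
        qed
      qed
      obtain a where a: "E a (hd u)" "E a (hd q)" "E a (hd r)"
        using LTC[OF uV assms(3) dist2[OF 2(1) y(2)] dist2[OF 2(2) y'(2)]] by blast
      then obtain t where t: "A u t" "hd t = a" using star[OF uX _ E_sym[OF a(1)]] 2 by fastforce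
      have "A' q t" using A'_quad[OF A'I(1)[OF 2(1)] A'I(2)[OF y(2)] A'I(1)[OF t(1)]] t a E_sym 2 upD[OF y(1)] by auto
      moreover have "A' r t" using A'_quad[OF A'I(1)[OF 2(2)] A'I(2)[OF y'(2)] A'I(1)[OF t(1)]] t a E_sym 2 upD[OF y'(1)] by auto
      moreover have "length t \<le> N" using A_len' t by blast
      ultimately show ?thesis using A'_adj_le A'_sym assms(3) by blast
    qed
  qed
qed

lemma X'_cases: "p \<in> X' \<Longrightarrow> p \<in> X \<and> length p \<le> N \<or> length p = Suc N \<and> (\<exists>w. up w p)"
  unfolding X'_def using X_len upD by blast

text \<open>The goals follow the order of the assumptions of \<open>partial_cover\<close>. Raising
  \<open>N\<close> asks for all lifts at the former last sphere, which is
  \<open>A'_star\<close>.\<close>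

lemma extension: "partial_cover V E b (Suc N) X' A'"
proof (unfold_locales, goal_cases)
  case 1 show ?case by simp
next
  case (2 p q) then show ?case unfolding A'_def X'_def hor_def using A_X upD by blast
next
  case (3 p q) then show ?case by (rule A'_sym)
next
  case (4 p q) then show ?case by (rule A'_E)
next
  case (5 p q) then show ?case using A'_len by blast
next
  case (6 p) then show ?case using X'_cases[OF 6] X_len[of p] by auto
next
  case (7 p) then show ?case unfolding X'_def using X_V upD E_V by blast
next
  case 8 show ?case unfolding X'_def using X_root by blast
next
  case (9 p) then show ?case using X'_cases[of p] X_root(2)[of p] N_pos by auto
next
  case (10 p)
  then show ?case using X'_cases[OF 10(1)] lower A'I upD by metis
next
  case (11 p q)
  show ?case
  proof (cases "length p \<le> N")
    case True
    then show ?thesis using 11 A'_le TC A'I(1) by metis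
  next
    case False
    then have "hor p q" using 11 A'_hor A'_len[OF 11(1)] by simp
    then obtain w where "up w p" "up w q" unfolding hor_def by blast
    then show ?thesis using A'I(2) upD by metis
  qed
next
  case (12 p z q)
  show ?case
  proof (cases "length z \<le> N")
    case True
    then show ?thesis using 12 A'_le QC[of p z q] A'I(1) by (metis Suc_leD)
  next
    case False
    then have "length z = Suc N" using A'_len[OF 12(1)] by simp
    then have "up p z" "up q z" "length p = N" using 12 A'_up by auto
    then have "com p q" using up_com by blast
    then show ?thesis unfolding com_def \<open>length p = N\<close> using A'I(1) by blast
  qed
next
  case (13 p z) then show ?case using A'_star X'_cases[OF 13(1)] by auto
next
  case (14 p q r) then show ?case by (rule A'_inj)
next
  case (15 p q r) then show ?case by (rule A'_adj)
next
  case (16 p q c e) then show ?case using A'_quad[of p q c e] by simp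
qed

lemma extension_ex:
  "\<exists>X' A'. partial_cover V E b (Suc N) X' A' \<and> X \<subseteq> X' \<and> (\<forall>p q. A p q \<longrightarrow> A' p q)"
  using extension A'I(1) unfolding X'_def by blast

end

section \<open>The universal cover\<close>

text \<open>The limit of the partial covers: the same conditions without the radius.\<close>

locale full_cover = lwm_graph V E b for V :: "'a set" and E and b +
  fixes X :: "'a list set" and A :: "'a list \<Rightarrow> 'a list \<Rightarrow> bool"
  assumes A_X: "A p q \<Longrightarrow> p \<in> X"
    and A_sym: "A p q \<Longrightarrow> A q p"
    and A_E: "A p q \<Longrightarrow> E (hd p) (hd q)"
    and A_len: "A p q \<Longrightarrow> length q \<le> Suc (length p)"
    and X_len: "p \<in> X \<Longrightarrow> 1 \<le> length p"
    and X_V: "p \<in> X \<Longrightarrow> hd p \<in> V"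
    and X_root: "[b] \<in> X" "p \<in> X \<Longrightarrow> length p = 1 \<Longrightarrow> p = [b]"
    and lower: "p \<in> X \<Longrightarrow> 1 < length p \<Longrightarrow> \<exists>q. A q p \<and> Suc (length q) = length p"
    and TC: "A p q \<Longrightarrow> length p = length q \<Longrightarrow> \<exists>r. A r p \<and> A r q \<and> Suc (length r) = length p"
    and QC: "A p z \<Longrightarrow> A q z \<Longrightarrow> Suc (length p) = length z \<Longrightarrow> Suc (length q) = length z
      \<Longrightarrow> p = q \<or> (\<exists>r. A r p \<and> A r q \<and> Suc (length r) = length p)"
    and star: "p \<in> X \<Longrightarrow> E (hd p) a \<Longrightarrow> \<exists>q. A p q \<and> hd q = a"
    and inj: "A p q \<Longrightarrow> A p r \<Longrightarrow> hd q = hd r \<Longrightarrow> q = r"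
    and adj: "A p q \<Longrightarrow> A p r \<Longrightarrow> E (hd q) (hd r) \<Longrightarrow> A q r"
    and quad: "A p q \<Longrightarrow> A q c \<Longrightarrow> A p e \<Longrightarrow> E (hd c) (hd e) \<Longrightarrow> A c e"

context lwm_graph
begin

text \<open>The ball of radius 0. \<open>star\<close> is vacuous because the only vertex has length
  \<open>N = 1\<close>.\<close>

lemma partial_cover_base: "partial_cover V E b 1 {[b]} (\<lambda>_ _. False)"
  by unfold_locales (auto simp: b_V)

lemma partial_cover_chain:
  "\<exists>X A. \<forall>n. partial_cover V E b (Suc n) (X n) (A n) \<and> X n \<subseteq> X (Suc n)
     \<and> (\<forall>p q. A n p q \<longrightarrow> A (Suc n) p q)"
proof -
  let ?P = "\<lambda>n XA. partial_cover V E b (Suc n) (fst XA) (snd XA)"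
  let ?Q = "\<lambda>XA YB. fst XA \<subseteq> fst YB \<and> (\<forall>p q. snd XA p q \<longrightarrow> snd YB p q)"
  have "\<exists>f. \<forall>n. ?P n (f n) \<and> ?Q (f n) (f (Suc n))"
  proof (rule dependent_nat_choice)
    show "\<exists>x. ?P 0 x" using partial_cover_base by auto
    show "\<exists>y. ?P (Suc n) y \<and> ?Q x y" if "?P n x" for n x
      using partial_cover.extension_ex[OF that] by auto
  qed
  then obtain f where "\<forall>n. ?P n (f n) \<and> ?Q (f n) (f (Suc n))" by blast
  then show ?thesis by (intro exI[of _ "\<lambda>n. fst (f n)"] exI[of _ "\<lambda>n. snd (f n)"]) auto
qed

lemma full_cover_ex: "\<exists>X A. full_cover V E b X A"
proof -
  obtain X A where pc: "\<And>n. partial_cover V E b (Suc n) (X n) (A n)"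
    and XS: "\<And>n. X n \<subseteq> X (Suc n)" and AS: "\<And>n p q. A n p q \<Longrightarrow> A (Suc n) p q"
    using partial_cover_chain by metis
  have X_mono: "X m \<subseteq> X n" if "m \<le> n" for m n
    using lift_Suc_mono_le[of X] XS that by blast
  have A_mono: "A n p q" if "A m p q" "m \<le> n" for m n p q
    using that(2,1) by (induction n rule: dec_induct) (auto intro: AS)
  let ?X = "\<Union>n. X n" and ?A = "\<lambda>p q. \<exists>n. A n p q"
  have two: "\<exists>n. A n p q \<and> A n r s" if "?A p q" "?A r s" for p q r s
    using that A_mono max.cobounded1 max.cobounded2 by metis
  \<comment> \<open>The bound \<open>k\<close> will be \<open>length p + length q\<close>, so that
    both lengths lie below the parameter \<open>Suc n\<close> of stage \<open>n\<close>, as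
    \<open>quad\<close> requires.\<close>
  have four: "\<exists>n. k \<le> n \<and> A n p q \<and> A n r s \<and> A n t u" if h: "?A p q" "?A r s" "?A t u" for k p q r s t u
  proof -
    obtain i j m where "A i p q" "A j r s" "A m t u" using h by blast
    then have "A (k+i+j+m) p q" "A (k+i+j+m) r s" "A (k+i+j+m) t u"
      using A_mono[of i p q "k+i+j+m"] A_mono[of j r s "k+i+j+m"] A_mono[of m t u "k+i+j+m"] by auto
    then show ?thesis by (intro exI[of _ "k+i+j+m"]) auto
  qed
  have "full_cover V E b ?X ?A"
  proof (unfold_locales, goal_cases)
    case 1 then show ?case using partial_cover.A_X[OF pc] by blast
  next
    case 2 then show ?case using partial_cover.A_sym[OF pc] by blast
  next
    case 3 then show ?case using partial_cover.A_E[OF pc] by blast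
  next
    case 4 then show ?case using partial_cover.A_len[OF pc] by blast
  next
    case 5 then show ?case using partial_cover.X_len[OF pc] by blast
  next
    case 6 then show ?case using partial_cover.X_V[OF pc] by blast
  next
    case 7 then show ?case using partial_cover.X_root(1)[OF pc] by blast
  next
    case 8 then show ?case using partial_cover.X_root(2)[OF pc] by blast
  next
    case 9 then show ?case using partial_cover.lower[OF pc] by blast
  next
    case 10 then show ?case using partial_cover.TC[OF pc] by blast
  next
    case (11 p z q)
    then obtain n where "A n p z" "A n q z" using two by blast
    then show ?case using partial_cover.QC[OF pc] 11(3,4) by blast
  next
    case (12 p a)
    then obtain m where m: "p \<in> X m" by blast
    \<comment> \<open>At this stage the parameter \<open>Suc (m + length p)\<close> exceeds
      \<open>length p\<close>, so \<open>p\<close> is off the last sphere and has all its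
      lifts.\<close>
    then have "p \<in> X (m + length p)" using X_mono[of m "m + length p"] by auto
    then show ?case using partial_cover.star[OF pc, of p "m + length p" a] 12(2) by auto
  next
    case (13 p q r)
    then obtain n where "A n p q" "A n p r" using two by blast
    then show ?case using partial_cover.inj[OF pc] 13(3) by blast
  next
    case (14 p q r)
    then obtain n where "A n p q" "A n p r" using two by blast
    then show ?case using partial_cover.adj[OF pc] 14(3) by blast
  next
    case (15 p q c e)
    then obtain n where "length p + length q \<le> n" "A n p q" "A n q c" "A n p e"
      using four[of p q q c p e "length p + length q"] by blast
    then show ?case using partial_cover.quad[OF pc, of n p q c e] 15(4) by auto
  qed
  then show ?thesis by blast
qed

end

context full_cover
begin

section \<open>Unique lifting of walks and homotopies\<close>

lemma A_X2: "A p q \<Longrightarrow> q \<in> X"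
  using A_X A_sym by blast

text \<open>Staying put when \<open>z\<close> is the current vertex lets a walk, first vertex included, be
  lifted by a plain fold from the root.\<close>

definition step :: "'a list \<Rightarrow> 'a \<Rightarrow> 'a list" where
  "step q z = (if z = hd q then q else THE r. A q r \<and> hd r = z)"

lemma step_self [simp]: "step q (hd q) = q"
  by (simp add: step_def)

lemma step_A: "A q r \<Longrightarrow> step q (hd r) = r"
  using A_E[of q r] inj by (auto simp: step_def intro!: the_equality)

lemma step: "q \<in> X \<Longrightarrow> E (hd q) z \<Longrightarrow> A q (step q z) \<and> hd (step q z) = z"
  using star[of q z] step_A[of q] by force

abbreviation lift :: "'a list \<Rightarrow> 'a list \<Rightarrow> 'a list" where
  "lift \<equiv> foldl step"

text \<open>The strict inequality comes from the first vertex of \<open>p\<close>, at which the fold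
  stays put; every later vertex raises the level by at most one.\<close>

lemma lift_walk:
  assumes "walk E p" "q \<in> X" "hd q = hd p"
  shows "lift q p \<in> X \<and> hd (lift q p) = last p \<and> length (lift q p) < length p + length q"
  using assms(1,3)
proof (induction p rule: rev_induct)
  case Nil
  then show ?case by simp
next
  case (snoc x p)
  show ?case
  proof (cases "p = []")
    case True
    then show ?thesis using snoc assms step_self[of q] by simp
  next
    case False
    then have w: "walk E p" "E (last p) x" using snoc by (auto simp: walk_append)
    then have IH: "lift q p \<in> X" "hd (lift q p) = last p" "length (lift q p) < length p + length q"
      using snoc False by auto
    then have "A (lift q p) (step (lift q p) x) \<and> hd (step (lift q p) x) = x"
      using step w by simp
    then show ?thesis using A_X2 A_len[of "lift q p" "step (lift q p) x"] IH by auto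
  qed
qed

text \<open>The loops inserted by the three moves lift to closed walks; this is shown here for
  backtracks and next for triangles and squares.\<close>

lemma lift_loop2: "q \<in> X \<Longrightarrow> E (hd q) x \<Longrightarrow> lift q [x, hd q] = q"
  using step[of q x] step_A[of "step q x" q] A_sym by simp

lemma lift_loop3:
  assumes "q \<in> X" "E (hd q) x" "E x y" "E y (hd q)"
  shows "lift q [x, y, hd q] = q"
proof -
  obtain r where r: "A q r" "hd r = x" using star assms by blast
  obtain s where s: "A q s" "hd s = y" using star assms E_sym by blast
  have "A r s" using adj r s assms by blast
  then show ?thesis using r s step_A[of q r] step_A[of r s] step_A[of s q] A_sym by simp
qed

lemma lift_loop4:
  assumes "q \<in> X" "E (hd q) x" "E x y" "E y z" "E z (hd q)"
  shows "lift q [x, y, z, hd q] = q"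
proof -
  obtain r where r: "A q r" "hd r = x" using star assms by blast
  obtain s where s: "A r s" "hd s = y" using star[of r y] r assms A_X2 by blast
  obtain t where t: "A q t" "hd t = z" using star[of q z] assms E_sym by blast
  have "A s t" using quad[OF r(1) s(1) t(1)] s t assms by simp
  then show ?thesis using r s t step_A[of q r] step_A[of r s] step_A[of s t] step_A[of t q] A_sym by simp
qed

lemma lift_move_aux:
  assumes "\<And>q. q \<in> X \<Longrightarrow> hd q = a \<Longrightarrow> lift q c = q" "walk E (xs @ [a])" "hd (xs @ [a]) = b"
  shows "lift [b] (xs @ [a] @ ys) = lift [b] (xs @ ([a] @ c) @ ys)"
proof -
  let ?q = "lift [b] (xs @ [a])"
  have "?q \<in> X" "hd ?q = a" using lift_walk[OF assms(2) X_root(1)] assms(3) by auto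
  then have "lift ?q c = ?q" using assms(1) by blast
  moreover have "lift [b] (xs @ [a] @ ys) = lift ?q ys" by simp
  moreover have "lift [b] (xs @ ([a] @ c) @ ys) = lift (lift ?q c) ys" by simp
  ultimately show ?thesis by simp
qed

definition based :: "'a list \<Rightarrow> bool" where "based p \<longleftrightarrow> walk E p \<and> hd p = b"

lemma walk_append3:
  "D \<noteq> [] \<Longrightarrow> walk E (xs @ D @ ys) \<longleftrightarrow> (xs = [] \<or> walk E xs \<and> E (last xs) (hd D)) \<and> walk E D
    \<and> (ys = [] \<or> walk E ys \<and> E (last D) (hd ys))"
  by (cases "xs = []"; cases "ys = []") (auto simp: walk_append)

lemma based_insert:
  assumes "walk E ([a] @ c)" "last ([a] @ c) = a"
  shows "based (xs @ [a] @ ys) \<longleftrightarrow> based (xs @ ([a] @ c) @ ys)"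
proof -
  have "hd (xs @ [a] @ ys) = hd (xs @ ([a] @ c) @ ys)" by (cases xs) auto
  then show ?thesis
    using walk_append3[of "[a]" xs ys] walk_append3[of "[a] @ c" xs ys] assms
    unfolding based_def by simp
qed

lemma based_prefix: "based (xs @ [a] @ ys) \<Longrightarrow> walk E (xs @ [a]) \<and> hd (xs @ [a]) = b"
  using walk_append[of "xs @ [a]" ys E] by (cases "ys = []"; cases xs) (auto simp: based_def)

lemma lift_move_gen:
  assumes "walk E ([a] @ c)" "last ([a] @ c) = a"
    and "\<And>q. q \<in> X \<Longrightarrow> hd q = a \<Longrightarrow> lift q c = q"
  shows "(based (xs @ [a] @ ys) \<longleftrightarrow> based (xs @ ([a] @ c) @ ys)) \<and>
    (based (xs @ [a] @ ys) \<longrightarrow> lift [b] (xs @ [a] @ ys) = lift [b] (xs @ ([a] @ c) @ ys))"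
  using based_insert[OF assms(1,2)] lift_move_aux[OF assms(3)] based_prefix by blast

text \<open>Moves relate arbitrary lists and are used in both directions, so being a walk from
  \<open>b\<close> has to be an invariant both ways.\<close>

lemma lift_move:
  "tsc_move E p q \<Longrightarrow> (based p \<longleftrightarrow> based q) \<and> (based p \<longrightarrow> lift [b] p = lift [b] q)"
proof (induction rule: tsc_move.induct)
  case (backtrack a x xs ys)
  then show ?case using lift_move_gen[of a "[x, a]" xs ys] E_sym lift_loop2 by auto
next
  case (triangle a x y xs ys)
  then show ?case using lift_move_gen[of a "[x, y, a]" xs ys] lift_loop3 by auto
next
  case (square a x y z xs ys)
  then show ?case
    using lift_move_gen[of a "[x, y, z, a]" xs ys] lift_loop4 by (auto simp: induced_4cycle_def)
qed

lemma lift_homotopic: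
  assumes "equivclp (tsc_move E) p q" "based p"
  shows "based q \<and> lift [b] p = lift [b] q"
  using assms
proof (induction rule: equivclp_induct)
  case base
  then show ?case by simp
next
  case (step y z)
  then show ?case using lift_move by metis
qed

text \<open>Descending along \<open>lower\<close> to the root gives the walk. Its exact length is
  what bounds distances by levels in \<open>hd_surj\<close>.\<close>

lemma lift_ex:
  "p \<in> X \<Longrightarrow> \<exists>w. based w \<and> lift [b] w = p \<and> length w = length p"
proof (induction "length p" arbitrary: p rule: less_induct)
  case less
  show ?case
  proof (cases "length p = 1")
    case True
    then have "p = [b]" using X_root less by blast
    then show ?thesis using step_self[of "[b]"] by (intro exI[of _ "[b]"]) (auto simp: based_def)
  next
    case False
    then have "1 < length p" using X_len less by fastforce
    then obtain q where q: "A q p" "Suc (length q) = length p" using lower less by blast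
    obtain w where w: "based w" "lift [b] w = q" "length w = length q"
      using less.hyps[of q] q A_X by auto
    have "w \<noteq> []" using w(1) by (auto simp: based_def)
    moreover have "last w = hd q" using w(1,2) lift_walk[of w "[b]"] X_root(1) by (simp add: based_def)
    ultimately have "based (w @ [hd p])" using w A_E q by (simp add: based_def walk_append)
    then show ?thesis using w q step_A[OF q(1)] by (intro exI[of _ "w @ [hd p]"]) auto
  qed
qed

lemma lift_cancel:
  assumes "p \<in> X" "q \<in> X" "hd p = hd q" "walk E (hd p # zs)" "lift p zs = lift q zs"
  shows "p = q"
  using assms
proof (induction zs arbitrary: p q)
  case Nil
  then show ?case by simp
next
  case (Cons z zs)
  have e: "E (hd p) z" "E (hd q) z" using Cons.prems(3,4) by auto
  have s: "A p (step p z)" "hd (step p z) = z" "A q (step q z)" "hd (step q z) = z"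
    using step e Cons.prems by auto
  have "step p z = step q z"
    using Cons.IH[of "step p z" "step q z"] s A_X2 Cons.prems by auto
  then have "A (step p z) p" "A (step p z) q" using s A_sym by auto
  then show ?case using inj Cons.prems(3) by blast
qed

section \<open>Bijectivity of the covering map\<close>

lemma walk_rev: "walk E p \<Longrightarrow> walk E (rev p)"
  by (auto simp: walk_successively elim!: successively_mono intro: E_sym)

text \<open>Take walks \<open>u\<close>, \<open>v\<close> from \<open>b\<close> whose lifts end in
  \<open>p\<close>, \<open>q\<close>. Following either by the reverse of \<open>v\<close> gives a
  closed walk, which is contractible and so lifts to a closed walk. Thus the reverse of
  \<open>v\<close> leads from both \<open>p\<close> and \<open>q\<close> to \<open>[b]\<close>, and
  lifts can be traced back uniquely.\<close>

lemma hd_inj: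
  assumes sc: "tsc_simply_connected E" and "p \<in> X" "q \<in> X" "hd p = hd q"
  shows "p = q"
proof -
  obtain u where u: "based u" "lift [b] u = p" using lift_ex assms by blast
  obtain v where v: "based v" "lift [b] v = q" using lift_ex assms by blast
  have uv: "walk E u" "walk E v" "hd u = b" "hd v = b" "last u = hd p" "last v = hd p"
    using u v lift_walk[of u "[b]"] lift_walk[of v "[b]"] X_root(1) assms by (auto simp: based_def)
  have ne: "u \<noteq> []" "v \<noteq> []" using uv by auto
  define zs where "zs = tl (rev v)"
  have rv: "rev v = hd p # zs" using ne uv unfolding zs_def
    by (metis hd_rev list.collapse rev_is_Nil_conv)
  have wz: "walk E (hd p # zs)" using walk_rev[OF uv(2)] rv by simp
  have lz: "last (hd p # zs) = b" using uv rv ne by (metis last_rev)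
  have "lift r zs = [b]" if w: "walk E w" "hd w = b" "last w = hd p" "lift [b] w = r" for w r
  proof -
    have "w \<noteq> []" using w by auto
    have ww: "walk E (w @ zs) \<and> last (w @ zs) = b"
    proof (cases "zs = []")
      case True
      then show ?thesis using w lz by simp
    next
      case False
      then have "walk E zs" "E (hd p) (hd zs)" using wz by (cases zs; auto)+
      then show ?thesis using w False lz \<open>w \<noteq> []\<close> by (auto simp: walk_append)
    qed
    then have hom: "equivclp (tsc_move E) (w @ zs) [b]"
      using sc w \<open>w \<noteq> []\<close> unfolding tsc_simply_connected_def by (metis hd_append2)
    have "based (w @ zs)" using ww w(2) \<open>w \<noteq> []\<close> by (simp add: based_def)
    then have "lift [b] (w @ zs) = lift [b] [b]" using lift_homotopic[OF hom] by blast
    then show ?thesis using w step_self[of "[b]"] by simp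
  qed
  then have "lift p zs = [b]" "lift q zs = [b]" using uv u v by blast+
  then show ?thesis using lift_cancel[OF assms(2-4) wz] by simp
qed

text \<open>Lifting a geodesic bounds the level from above; projecting a shortest descent from the
  lift bounds it from below.\<close>

lemma hd_surj:
  assumes "v \<in> V"
  shows "\<exists>p\<in>X. hd p = v \<and> length p = Suc (d b v)"
proof -
  obtain w where w: "walk E w" "hd w = b" "last w = v" "length w = Suc (d b v)"
    using dist_walk[OF b_V assms] by blast
  let ?p = "lift [b] w"
  have p: "?p \<in> X" "hd ?p = v" "length ?p \<le> Suc (d b v)"
    using lift_walk[OF w(1) X_root(1)] w by auto
  obtain u where u: "based u" "lift [b] u = ?p" "length u = length ?p" using lift_ex p by blast
  have "last u = v" using u lift_walk[of u "[b]"] X_root(1) p by (simp add: based_def)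
  then have "d b v \<le> length ?p - 1" using dist_le_walk[of u] u by (auto simp: based_def)
  then have "length ?p = Suc (d b v)" using p X_len[OF p(1)] by linarith
  then show ?thesis using p by blast
qed

lemma weakly_modular_at_base:
  assumes sc: "tsc_simply_connected E"
  shows "\<And>v w. E v w \<Longrightarrow> d b v = d b w \<Longrightarrow> \<exists>x. E x v \<and> E x w \<and> Suc (d b x) = d b v"
    and "\<And>v w z. E v z \<Longrightarrow> E w z \<Longrightarrow> v \<noteq> w \<Longrightarrow> d b z = Suc (d b v) \<Longrightarrow> d b z = Suc (d b w)
      \<Longrightarrow> \<exists>x. E x v \<and> E x w \<and> Suc (d b x) = d b v"
proof -
  \<comment> \<open>With injectivity, the level of every vertex of the cover is the distance of its
    projection from \<open>b\<close>, so \<open>TC\<close> and \<open>QC\<close> descend to the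
    graph.\<close>
  have len: "length p = Suc (d b (hd p))" if "p \<in> X" for p
    using hd_surj[OF X_V[OF that]] hd_inj[OF sc _ that] by metis
  have lift_edge: "\<exists>p q. A p q \<and> hd p = v \<and> hd q = w" if "E v w" for v w
    using that hd_surj star E_V by metis
  {
    fix v w assume a: "E v w" "d b v = d b w"
    then obtain p q where pq: "A p q" "hd p = v" "hd q = w" using lift_edge by blast
    then have "length p = length q" using len A_X A_X2 a by metis
    then obtain r where r: "A r p" "A r q" "Suc (length r) = length p" using TC pq by blast
    then have "E (hd r) v" "E (hd r) w" "Suc (d b (hd r)) = d b v"
      using A_E pq len[OF A_X[OF r(1)]] len[OF A_X[OF pq(1)]] by auto
    then show "\<exists>x. E x v \<and> E x w \<and> Suc (d b x) = d b v" by blast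
  next
    fix v w z assume a: "E v z" "E w z" "v \<noteq> w" "d b z = Suc (d b v)" "d b z = Suc (d b w)"
    obtain p s where ps: "A p s" "hd p = v" "hd s = z" using lift_edge a by blast
    obtain q s' where qs: "A q s'" "hd q = w" "hd s' = z" using lift_edge a by blast
    have "s' = s" using hd_inj[OF sc] A_X2 ps qs by metis
    then have qs: "A q s" using qs by simp
    have l: "length p = Suc (d b v)" "length q = Suc (d b w)" "length s = Suc (d b z)"
      using len A_X A_X2 ps qs \<open>hd q = w\<close> by metis+
    then obtain r where r: "A r p" "A r q" "Suc (length r) = length p"
      using QC[OF ps(1) qs] a ps \<open>hd q = w\<close> by auto
    then have "E (hd r) v" "E (hd r) w" "Suc (d b (hd r)) = d b v"
      using A_E[OF r(1)] A_E[OF r(2)] ps \<open>hd q = w\<close> len[OF A_X[OF r(1)]] l by auto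
    then show "\<exists>x. E x v \<and> E x w \<and> Suc (d b x) = d b v" by blast
  }
qed

end

context conn_graph
begin

text \<open>The cover gives the two conditions only at its base point, so one is built for every
  \<open>u\<close>.\<close>

lemma weakly_modularI:
  assumes sc: "tsc_simply_connected E" and lwm: "locally_weakly_modular V E"
  shows "weakly_modular V E"
proof -
  have main: "(\<forall>v w. E v w \<longrightarrow> d u v = d u w \<longrightarrow> (\<exists>x. E x v \<and> E x w \<and> Suc (d u x) = d u v)) \<and>
    (\<forall>v w z. E v z \<longrightarrow> E w z \<longrightarrow> v \<noteq> w \<longrightarrow> d u z = Suc (d u v) \<longrightarrow> d u z = Suc (d u w)
      \<longrightarrow> (\<exists>x. E x v \<and> E x w \<and> Suc (d u x) = d u v))" if u: "u \<in> V" for u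
  proof -
    interpret lwm_graph V E u
    proof (unfold_locales, goal_cases)
      case 1 show ?case by (rule u)
    next
      case (2 u v w)
      then show ?case using lwm E_V[of v w] unfolding locally_weakly_modular_def by blast
    next
      case (3 u z v w)
      then show ?case using lwm E_V[of z v] E_V[of z w] unfolding locally_weakly_modular_def by blast
    qed
    obtain X A where "full_cover V E u X A" using full_cover_ex by blast
    then interpret full_cover V E u X A .
    show ?thesis using weakly_modular_at_base[OF sc] by blast
  qed
  show ?thesis
    unfolding weakly_modular_def
  proof (intro ballI conjI impI, goal_cases)
    case (1 u v w)
    then show ?case using main[OF 1(1)] by (metis diff_Suc_1)
  next
    case (2 u v w z)
    then have "v \<noteq> w" by auto
    then obtain x where "E x v" "E x w" "Suc (d u x) = d u v" using main[OF 2(1)] 2 by fastforce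
    then show ?case by (metis diff_Suc_1)
  qed
qed

end

section \<open>Weakly modular graphs are simply connected\<close>

lemma tsc_move_context: "tsc_move E p q \<Longrightarrow> tsc_move E (xs @ p @ ys) (xs @ q @ ys)"
proof (induction rule: tsc_move.induct)
  case (backtrack a x us vs)
  then show ?case using tsc_move.backtrack[of E a x "xs @ us" "vs @ ys"] by simp
next
  case (triangle a x y us vs)
  then show ?case using tsc_move.triangle[of E a x y "xs @ us" "vs @ ys"] by simp
next
  case (square a x y z us vs)
  then show ?case using tsc_move.square[of E a x y z "xs @ us" "vs @ ys"] by simp
qed

abbreviation homot :: "('a \<Rightarrow> 'a \<Rightarrow> bool) \<Rightarrow> 'a list \<Rightarrow> 'a list \<Rightarrow> bool" where
  "homot E \<equiv> equivclp (tsc_move E)"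

lemma homot_context: "homot E p q \<Longrightarrow> homot E (xs @ p @ ys) (xs @ q @ ys)"
proof (induction rule: equivclp_induct)
  case base
  then show ?case by simp
next
  case (step y z)
  then have "homot E (xs @ y @ ys) (xs @ z @ ys)"
    using tsc_move_context[of E] by (metis equivclp_sym r_into_equivclp)
  then show ?case using step.IH equivclp_trans by metis
qed

lemma homot_append: "homot E p q \<Longrightarrow> homot E (p @ ys) (q @ ys)"
  using homot_context[of E p q "[]" ys] by simp

lemma homot_join: "tsc_move E p r \<Longrightarrow> tsc_move E q r \<Longrightarrow> homot E p q"
  by (meson equivclp_sym equivclp_trans r_into_equivclp)

context conn_graph
begin

lemma homot_backtrack: "E x y \<Longrightarrow> homot E [x, y, x] [x]"
  using tsc_move.backtrack[of E x y "[]" "[]"] by (simp add: equivclp_sym r_into_equivclp)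

text \<open>Moves only insert closed loops, so both sides are compared with their common expansion
  \<open>[x, y, z, x, z]\<close>.\<close>

lemma homot_triangle:
  assumes "E x y" "E y z" "E x z"
  shows "homot E [x, y, z] [x, z]"
  using homot_join[of E "[x, y, z]" "[x, y, z, x, z]" "[x, z]"]
    tsc_move.triangle[of E x y z "[]" "[z]"] tsc_move.backtrack[of E z x "[x, y]" "[]"] assms E_sym
  by simp

text \<open>Either the diagonal \<open>y y'\<close> splits the square into two triangles, or the
  square is induced and is a 2-cell.\<close>

lemma homot_square:
  assumes "E x y" "E y z" "E x y'" "E y' z" "y \<noteq> y'" "x \<noteq> z" "\<not> E x z"
  shows "homot E [x, y, z] [x, y', z]"
proof (cases "E y y'")
  case True
  have "homot E [x, y, z] [x, y, y', z]"
    using homot_context[OF homot_triangle[OF True assms(4,2)], of "[x]" "[]"] by (simp add: equivclp_sym)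
  moreover have "homot E [x, y, y', z] [x, y', z]"
    using homot_context[OF homot_triangle[OF assms(1) True assms(3)], of "[]" "[z]"] by simp
  ultimately show ?thesis by (rule equivclp_trans)
next
  case False
  then have sq: "induced_4cycle E x y z y'"
    using assms E_sym by (auto simp: induced_4cycle_def)
  have 1: "homot E [x, y', z] [x, y, z, y', x, y', z]"
    using tsc_move.square[OF sq, of "[]" "[y', z]"] by (simp add: r_into_equivclp)
  have 2: "homot E [x, y, z, y', x, y', z] [x, y, z, y', z]"
    using homot_context[OF homot_backtrack[of y' x], of "[x, y, z]" "[z]"] assms E_sym by simp
  have 3: "homot E [x, y, z, y', z] [x, y, z]"
    using homot_context[OF homot_backtrack[of z y'], of "[x, y]" "[]"] assms E_sym by simp
  show ?thesis using equivclp_trans[OF equivclp_trans[OF 1 2] 3] by (rule equivclp_sym)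
qed

lemma weakly_modular_TC:
  assumes wm: "weakly_modular V E" and "u \<in> V" "E v w" "d u v = d u w"
  shows "\<exists>x. E x v \<and> E x w \<and> Suc (d u x) = d u v"
proof -
  have V: "v \<in> V" "w \<in> V" using E_V assms by auto
  have "v \<noteq> w" using assms by auto
  then have "d u v \<noteq> 0" using d_0_iff V assms by metis
  then consider "d u v = 1" | "1 < d u v" by linarith
  then show ?thesis
  proof cases
    case 1
    then have "E u v" "E u w" using d_1 V assms by auto
    then show ?thesis using 1 by (intro exI[of _ u]) simp
  next
    case 2
    then obtain x where "E x v" "E x w" "d u x = d u v - 1"
      using wm assms V unfolding weakly_modular_def by blast
    then show ?thesis using 2 by auto
  qed
qed

text \<open>Compared with the definition, adjacent \<open>v\<close>, \<open>w\<close> are covered by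
  the triangle condition, and at distance 1 the vertex \<open>u\<close> itself serves.\<close>

lemma weakly_modular_QC:
  assumes wm: "weakly_modular V E" and "u \<in> V" "E v z" "E w z" "v \<noteq> w"
    "d u z = Suc (d u v)" "d u z = Suc (d u w)"
  shows "\<exists>x. E x v \<and> E x w \<and> Suc (d u x) = d u v"
proof -
  have V: "v \<in> V" "w \<in> V" "z \<in> V" using E_V assms by auto
  show ?thesis
  proof (cases "E v w")
    case True
    then show ?thesis using weakly_modular_TC[OF wm assms(2) True] assms by simp
  next
    case False
    then have dvw: "d v w = 2" using d_2I[of v z w] assms E_sym by blast
    have "d u v \<noteq> 0" using d_0_iff[of u v] d_0_iff[of u w] V assms by auto
    then consider "d u v = 1" | "2 \<le> d u v" by linarith
    then show ?thesis
    proof cases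
      case 1
      then have "E u v" "E u w" using d_1 V assms by auto
      then show ?thesis using 1 by (intro exI[of _ u]) simp
    next
      case 2
      have "E v z \<and> E w z \<and> d v w = 2 \<and> 2 \<le> d u v \<and> d u v = d u w \<and> d u z = d u v + 1 \<longrightarrow>
          (\<exists>x. E x v \<and> E x w \<and> d u x = d u v - 1)"
        using wm assms(2) V unfolding weakly_modular_def by blast
      moreover have "d u z = d u v + 1" "d u v = d u w" using assms(6,7) by auto
      ultimately obtain x where "E x v" "E x w" "d u x = d u v - 1"
        using assms(3,4) dvw 2 by blast
      then show ?thesis using 2 by auto
    qed
  qed
qed

definition geod :: "'a \<Rightarrow> 'a \<Rightarrow> 'a list \<Rightarrow> bool" where
  "geod u v p \<longleftrightarrow> walk E p \<and> hd p = u \<and> last p = v \<and> length p = Suc (d u v)"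

lemma geod_ex: "u \<in> V \<Longrightarrow> v \<in> V \<Longrightarrow> \<exists>p. geod u v p"
  using dist_walk unfolding geod_def by blast

lemma geod_snoc: "geod u v p \<Longrightarrow> E v w \<Longrightarrow> d u w = Suc (d u v) \<Longrightarrow> geod u w (p @ [w])"
  unfolding geod_def by (cases "p = []") (auto simp: walk_append)

lemma geod_E:
  assumes "geod u v p" "u \<in> V" "v \<in> V" "d u v = Suc n"
  obtains q w where "p = q @ [v]" "geod u w q" "E w v" "d u w = n"
proof -
  obtain q where q: "p = q @ [v]" using assms(1) unfolding geod_def by (cases p rule: rev_cases) auto
  have ne: "q \<noteq> []" using q assms unfolding geod_def by auto
  have w: "walk E q" "E (last q) v" "hd q = u" "length q = Suc n"
    using assms(1,4) q ne unfolding geod_def by (auto simp: walk_append)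
  have "d u (last q) \<le> n" using dist_le_walk[OF w(1)] w by simp
  moreover have "Suc n \<le> Suc (d u (last q))" using d_nb[OF assms(2) w(2)] assms(4) by simp
  ultimately have "d u (last q) = n" by simp
  then show ?thesis using that[of q "last q"] q w unfolding geod_def by simp
qed

text \<open>Induction on the distance: if the last vertices \<open>a\<close>, \<open>a'\<close>
  before \<open>v\<close> differ, the quadrangle condition gives \<open>x\<close> below both, and
  the two geodesics are compared through one via \<open>x\<close> and the square
  \<open>x a v a'\<close>.\<close>

lemma geod_homot:
  assumes wm: "weakly_modular V E" and u: "u \<in> V"
  shows "v \<in> V \<Longrightarrow> geod u v p \<Longrightarrow> geod u v q \<Longrightarrow> homot E p q"
proof (induction "d u v" arbitrary: v p q)
  case 0
  then have "u = v" using d_0_iff u by metis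
  then have "p = [u]" "q = [u]" using 0 unfolding geod_def
    by (auto simp: length_Suc_conv)
  then show ?case by simp
next
  case (Suc n)
  obtain p' a where p: "p = p' @ [v]" "geod u a p'" "E a v" "d u a = n"
    using geod_E[OF Suc.prems(2) u Suc.prems(1) Suc.hyps(2)[symmetric]] .
  obtain q' a' where q: "q = q' @ [v]" "geod u a' q'" "E a' v" "d u a' = n"
    using geod_E[OF Suc.prems(3) u Suc.prems(1) Suc.hyps(2)[symmetric]] .
  have V: "a \<in> V" "a' \<in> V" using E_V p q by auto
  show ?case
  proof (cases "a = a'")
    case True
    then have "homot E p' q'" using Suc.hyps(1)[of a p' q'] p(2,4) q(2) V by simp
    then show ?thesis using homot_append[of E p' q' "[v]"] p(1) q(1) by simp
  next
    case False
    then obtain x where x: "E x a" "E x a'" "Suc (d u x) = d u a"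
      using weakly_modular_QC[OF wm u p(3) q(3) False] p(4) q(4) Suc.hyps(2)[symmetric] by auto
    obtain r where r: "geod u x r" using geod_ex u E_V x by blast
    have 1: "homot E p' (r @ [a])" "homot E q' (r @ [a'])"
      using Suc.hyps(1)[of a p' "r @ [a]"] Suc.hyps(1)[of a' q' "r @ [a']"] geod_snoc[OF r x(1)] geod_snoc[OF r x(2)] x(3) p(2,4) q(2,4) V by auto
    have "d u v = Suc (Suc (d u x))" using x(3) p(4) Suc.hyps(2) by simp
    then have nx: "x \<noteq> v" "\<not> E x v" using d_nb[OF u, of x v] by auto
    obtain s where s: "r = s @ [x]" using r unfolding geod_def by (cases r rule: rev_cases) auto
    have "homot E (r @ [a, v]) (r @ [a', v])"
      using homot_context[OF homot_square[OF x(1) p(3) x(2) q(3) False nx], of s "[]"] s by simp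
    then show ?thesis
      using homot_append[OF 1(1), of "[v]"] homot_append[OF 1(2), of "[v]"] p q
      by simp (meson equivclp_sym equivclp_trans)
  qed
qed

text \<open>An added edge goes up, stays level or goes down with respect to \<open>u\<close>; in the
  last two cases the geodesic is first rerouted so that a triangle or a backtrack can be
  removed.\<close>

lemma walk_homot_geod:
  assumes wm: "weakly_modular V E" and u: "u \<in> V"
  shows "walk E p \<Longrightarrow> hd p = u \<Longrightarrow> \<exists>q. geod u (last p) q \<and> homot E p q"
proof (induction p rule: rev_induct)
  case Nil
  then show ?case by simp
next
  case (snoc w p)
  show ?case
  proof (cases "p = []")
    case True
    then show ?thesis using snoc.prems by (intro exI[of _ "[w]"]) (simp add: geod_def)
  next
    case False
    define v where "v = last p"
    have w: "walk E p" "hd p = u" "E v w" using snoc.prems False by (auto simp: walk_append v_def)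
    have V: "v \<in> V" "w \<in> V" using E_V w by auto
    obtain q where q: "geod u v q" "homot E p q" using snoc.IH w v_def by blast
    have pw: "homot E (p @ [w]) (q @ [w])" using homot_append q by blast
    have "d u w \<le> Suc (d u v)" "d u v \<le> Suc (d u w)"
      using d_nb[OF u w(3)] d_nb[OF u E_sym[OF w(3)]] by auto
    then consider (up) "d u w = Suc (d u v)" | (eq) "d u w = d u v" | (down) "d u v = Suc (d u w)"
      by linarith
    then have "\<exists>r. geod u w r \<and> homot E (q @ [w]) r"
    proof cases
      case up
      then show ?thesis using geod_snoc[OF q(1) w(3)] equivclp_refl by metis
    next
      case eq
      obtain x where x: "E x v" "E x w" "Suc (d u x) = d u v"
        using weakly_modular_TC[OF wm u w(3) eq[symmetric]] by blast
      obtain r where r: "geod u x r" using geod_ex u E_V x by blast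
      then obtain s where s: "r = s @ [x]" unfolding geod_def by (cases r rule: rev_cases) auto
      have "homot E q (r @ [v])"
        using geod_homot[OF wm u V(1) q(1) geod_snoc[OF r x(1)]] x by simp
      then have "homot E (q @ [w]) (r @ [v, w])" using homot_append by fastforce
      moreover have "homot E (r @ [v, w]) (r @ [w])"
        using homot_context[OF homot_triangle[OF x(1) w(3) x(2)], of s "[]"] s by simp
      ultimately have "homot E (q @ [w]) (r @ [w])" by (rule equivclp_trans)
      then show ?thesis using geod_snoc[OF r x(2)] x eq by auto
    next
      case down
      obtain r where r: "geod u w r" using geod_ex u V by blast
      then obtain s where s: "r = s @ [w]" unfolding geod_def by (cases r rule: rev_cases) auto
      have "homot E q (r @ [v])"
        using geod_homot[OF wm u V(1) q(1) geod_snoc[OF r E_sym[OF w(3)] down]] .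
      then have "homot E (q @ [w]) (r @ [v, w])" using homot_append by fastforce
      moreover have "homot E (r @ [v, w]) r"
        using homot_context[OF homot_backtrack[OF E_sym[OF w(3)]], of s "[]"] s by simp
      ultimately have "homot E (q @ [w]) r" by (rule equivclp_trans)
      then show ?thesis using r by blast
    qed
    then show ?thesis using equivclp_trans[OF pw] by auto
  qed
qed

lemma weakly_modular_simply_connected:
  assumes wm: "weakly_modular V E"
  shows "tsc_simply_connected E"
proof -
  have "homot E p [hd p]" if p: "walk E p" "hd p = last p" for p
  \<comment> \<open>A one-vertex list is a walk even outside \<open>V\<close>; only an edge
    guarantees \<open>hd p \<in> V\<close>.\<close>
  proof (cases "tl p = []")
    case True
    then have "p = [hd p]" using p by (cases p) auto
    then show ?thesis by (metis equivclp_refl)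
  next
    case False
    then obtain x y q where "p = x # y # q" by (cases p; cases "tl p") auto
    then have "hd p \<in> V" using p E_V by auto
    then obtain q where q: "geod (hd p) (hd p) q" "homot E p q"
      using walk_homot_geod[OF wm _ p(1)] p(2) by metis
    then have "q = [hd p]" unfolding geod_def by (auto simp: length_Suc_conv)
    then show ?thesis using q by simp
  qed
  then show ?thesis unfolding tsc_simply_connected_def by blast
qed

lemma weakly_modular_locally:
  assumes wm: "weakly_modular V E"
  shows "locally_weakly_modular V E"
  unfolding locally_weakly_modular_def
proof (intro ballI conjI impI, goal_cases)
  case (1 u v w)
  then obtain x where "E x v" "E x w" "Suc (d u x) = d u v"
    using weakly_modular_TC[OF wm 1(1), of v w] by auto
  moreover from this 1 have "E x u" using d_1[of u x] E_V[of x v] E_sym by auto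
  ultimately show ?case by blast
next
  case (2 u v w z)
  then have "v \<noteq> w" by auto
  then obtain x where "E x v" "E x w" "Suc (d u x) = d u v"
    using weakly_modular_QC[OF wm 2(1), of v z w] 2 E_sym by auto
  moreover from this 2 have "E x u" using d_1[of u x] E_V[of x v] E_sym by auto
  ultimately show ?case by blast
qed

end

section \<open>Forbidden subgraphs\<close>

lemma not_contains_K4mD:
  assumes "\<not> contains_induced V E K4m_V K4m_E" "{a, b, c, e} \<subseteq> V" "symp E" "irreflp E"
    and "E a b" "E a c" "E b c" "E b e" "E c e" "a \<noteq> e"
  shows "E a e"
proof (rule ccontr)
  assume "\<not> E a e"
  let ?f = "\<lambda>i. [a, b, c, e] ! i"
  have s: "E x y \<Longrightarrow> E y x" "\<not> E x x" for x y
    using assms(3,4) by (auto dest: sympD irreflpD)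
  have "distinct [a, b, c, e]" using s assms by auto
  then have "inj_on ?f K4m_V \<and> ?f ` K4m_V \<subseteq> V \<and>
     (\<forall>x\<in>K4m_V. \<forall>y\<in>K4m_V. E (?f x) (?f y) \<longleftrightarrow> K4m_E x y)"
    using \<open>\<not> E a e\<close> assms(2,5-10) s(1)[of a b] s(1)[of a c] s(1)[of b c] s(1)[of b e] s(1)[of c e]
      s(1)[of e a] s(2)
    by (auto simp: K4m_V_def K4m_E_def inj_on_def doubleton_eq_iff)
  then show False using assms(1) unfolding contains_induced_def by (metis (no_types, lifting))
qed

lemma contains_K4mD:
  assumes "contains_induced V E K4m_V K4m_E"
  obtains a b c e where "{a, b, c, e} \<subseteq> V" "E a b" "E a c" "E b c" "E b e" "E c e" "a \<noteq> e" "\<not> E a e"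
proof -
  obtain f where "inj_on f K4m_V \<and> f ` K4m_V \<subseteq> V \<and>
     (\<forall>x\<in>K4m_V. \<forall>y\<in>K4m_V. E (f x) (f y) \<longleftrightarrow> K4m_E x y)"
    using assms unfolding contains_induced_def by (rule exE)
  then have f: "inj_on f K4m_V" "f ` K4m_V \<subseteq> V"
     "\<And>x y. x\<in>K4m_V \<Longrightarrow> y\<in>K4m_V \<Longrightarrow> E (f x) (f y) \<longleftrightarrow> K4m_E x y"
    by simp_all
  have m: "0 \<in> K4m_V" "1 \<in> K4m_V" "2 \<in> K4m_V" "3 \<in> K4m_V" by (auto simp: K4m_V_def)
  have "K4m_E 0 1" "K4m_E 0 2" "K4m_E 1 2" "K4m_E 1 3" "K4m_E 2 3" "\<not> K4m_E 0 3"
    by (simp_all add: K4m_E_def K4m_V_def doubleton_eq_iff)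
  moreover have "f 0 \<noteq> f 3" using inj_onD[OF f(1) _ m(1,4)] by auto
  moreover have "{f 0, f 1, f 2, f 3} \<subseteq> V" using f(2) m by auto
  ultimately show thesis using that[of "f 0" "f 1" "f 2" "f 3"] f(3) m by simp
qed

definition K33m_dist :: "nat \<Rightarrow> nat \<Rightarrow> nat" where
  "K33m_dist i j = (if i = j then 0 else if K33m_E i j then 1 else if {i, j} = {0, 3} then 3 else 2)"

lemma graph_K33m: "graph K33m_V K33m_E"
proof -
  have "\<exists>p. walk K33m_E p \<and> hd p = u \<and> last p = v" if uv: "u \<in> K33m_V" "v \<in> K33m_V" for u v
  proof -
    \<comment> \<open>The vertices 1 and 4 do not meet the removed edge, so each is adjacent to the
      whole opposite side.\<close>
    let ?p = "if u = v then [u] else if K33m_E u v then [u, v]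
      else if u = 0 \<and> v = 3 then [0, 4, 1, 3] else if u = 3 \<and> v = 0 then [3, 1, 4, 0]
      else if u < 3 then [u, 4, v] else [u, 1, v]"
    have "walk K33m_E ?p \<and> hd ?p = u \<and> last ?p = v"
      using uv by (auto simp: K33m_E_def K33m_V_def doubleton_eq_iff)
    then show ?thesis by blast
  qed
  moreover have "K33m_E u v \<longrightarrow> u \<in> K33m_V \<and> v \<in> K33m_V \<and> K33m_E v u \<and> u \<noteq> v" for u v
    unfolding K33m_E_def by (auto simp: doubleton_eq_iff)
  moreover have "K33m_V \<noteq> {}" by (simp add: K33m_V_def)
  ultimately show ?thesis unfolding graph_def by blast
qed

lemma dist_K33m:
  assumes "i \<in> K33m_V" "j \<in> K33m_V"
  shows "dist K33m_E i j = K33m_dist i j"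
proof -
  interpret K: conn_graph K33m_V K33m_E by unfold_locales (rule graph_K33m)
  have E: "K33m_E i j \<longleftrightarrow> i < 3 \<and> 3 \<le> j \<and> \<not> (i = 0 \<and> j = 3) \<or> j < 3 \<and> 3 \<le> i \<and> \<not> (i = 3 \<and> j = 0)"
    if "i \<le> 5" "j \<le> 5" for i j
    using that by (auto simp: K33m_E_def K33m_V_def doubleton_eq_iff)
  have le5: "i \<in> K33m_V \<longleftrightarrow> i \<le> 5" for i by (auto simp: K33m_V_def)
  consider "i = j" | "K33m_E i j" | "i \<noteq> j" "\<not> K33m_E i j" "i = 0 \<and> j = 3 \<or> i = 3 \<and> j = 0"
    | "i \<noteq> j" "\<not> K33m_E i j" "\<not> (i = 0 \<and> j = 3 \<or> i = 3 \<and> j = 0)" by argo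
  then show ?thesis
  proof cases
    case 1
    then show ?thesis by (simp add: K33m_dist_def)
  next
    case 2
    then show ?thesis using K.d_edge[OF 2] K.E_irrefl[of i] by (auto simp: K33m_dist_def)
  next
    case 3
    have "\<not> K.d 0 3 \<le> 2"
    proof
      assume "K.d 0 3 \<le> 2"
      then show False
      proof (rule K.d_le_2_cases[rotated 2])
        assume "K.d 0 3 = 2"
        then obtain w where "K33m_E 0 w" "K33m_E w 3" using K.d_2E[of 0 3] le5 by auto
        then show False by (auto simp: K33m_E_def)
      qed (auto simp: le5 E)
    qed
    moreover have "K.d 0 3 \<le> 3" using K.d_path3[of 0 4 1 3] by (simp add: E)
    ultimately have "K.d 0 3 = 3" by simp
    moreover have "K.d 3 0 = K.d 0 3" using K.d_sym le5 by simp
    ultimately show ?thesis using 3 by (auto simp: K33m_dist_def doubleton_eq_iff)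
  next
    case 4
    have "K.d i j = 2"
      using K.d_2I[of i "if i < 3 then 4 else 1" j] 4 assms by (auto simp: E le5 doubleton_eq_iff)
    then show ?thesis using 4 by (auto simp: K33m_dist_def)
  qed
qed

context conn_graph
begin

lemma contains_K33mI:
  assumes "E s p" "E s p'" "E t q" "E t q'" "E p q" "E p q'" "E p' q" "E p' q'"
    and "d s t = 3" "p \<noteq> p'" "q \<noteq> q'" "\<not> E p p'" "\<not> E q q'"
  shows "contains_isometric V E K33m_V K33m_E"
proof -
  \<comment> \<open>Positions 0 to 2 and 3 to 5 are the two sides; \<open>s\<close> and
    \<open>t\<close> take the places 0 and 3 of the removed edge.\<close>
  let ?l = "[s, q, q', t, p, p']"
  let ?f = "\<lambda>i. ?l ! i"
  have V: "set ?l \<subseteq> V" using assms(1-8) E_V by auto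
  have e: "d s p = 1" "d s p' = 1" "d t q = 1" "d t q' = 1" "d p q = 1" "d p q' = 1" "d p' q = 1" "d p' q' = 1"
    using assms(1-8) d_edge by auto
  have n: "\<not> d s t \<le> 2" using assms(9) by simp
  have "s \<noteq> q" "s \<noteq> q'" "t \<noteq> p" "t \<noteq> p'" "\<not> E s q" "\<not> E s q'" "\<not> E t p" "\<not> E t p'"
    using n d_path2 E_sym assms(1-8) d_edge[of s t] by fastforce+
  then have t: "d s q = 2" "d s q' = 2" "d t p = 2" "d t p' = 2" "d p p' = 2" "d q q' = 2"
    using d_2I[of s p q] d_2I[of s p q'] d_2I[of t q p] d_2I[of t q p'] d_2I[of p s p'] d_2I[of q t q']
      assms E_sym by auto
  have sym: "d p s = 1" "d p' s = 1" "d q t = 1" "d q' t = 1" "d q p = 1" "d q' p = 1" "d q p' = 1" "d q' p' = 1"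
    "d q s = 2" "d q' s = 2" "d p t = 2" "d p' t = 2" "d p' p = 2" "d q' q = 2" "d t s = 3"
    using e t assms(9) d_sym V by auto
  have dist: "d (?f i) (?f j) = dist K33m_E i j" if "i \<in> K33m_V" "j \<in> K33m_V" for i j
    unfolding dist_K33m[OF that]
    using that by (auto simp: K33m_V_def K33m_dist_def K33m_E_def doubleton_eq_iff e t sym assms(9))
  have "distinct ?l" using e t sym assms(9) d_self by auto
  then have "inj_on ?f K33m_V"
    using inj_on_nth[of ?l K33m_V] by (auto simp: K33m_V_def)
  moreover have "?f ` K33m_V \<subseteq> V" using V by (auto simp: K33m_V_def)
  ultimately show ?thesis using dist unfolding contains_isometric_def by blast
qed

lemma contains_K33mD:
  assumes "contains_isometric V E K33m_V K33m_E"
  obtains s p p' t q q' where "E s p" "E s p'" "E t q" "E t q'" "E p q" "E p q'" "E p' q" "E p' q'"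
    "d s t = 3" "d p p' = 2" "d q q' = 2"
proof -
  obtain f where "inj_on f K33m_V \<and> f ` K33m_V \<subseteq> V \<and>
     (\<forall>x\<in>K33m_V. \<forall>y\<in>K33m_V. d (f x) (f y) = dist K33m_E x y)"
    using assms unfolding contains_isometric_def by (rule exE)
  then have f: "f ` K33m_V \<subseteq> V"
     "\<And>x y. x\<in>K33m_V \<Longrightarrow> y\<in>K33m_V \<Longrightarrow> d (f x) (f y) = K33m_dist x y"
    using dist_K33m by simp_all
  have m: "0 \<in> K33m_V" "1 \<in> K33m_V" "2 \<in> K33m_V" "3 \<in> K33m_V" "4 \<in> K33m_V" "5 \<in> K33m_V"
    by (auto simp: K33m_V_def)
  have e: "E (f i) (f j)" if "i \<in> K33m_V" "j \<in> K33m_V" "K33m_dist i j = 1" for i j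
    using that f(1) f(2)[OF that(1,2)] d_1[of "f i" "f j"] by auto
  show thesis
    by (rule that[of "f 0" "f 4" "f 5" "f 3" "f 1" "f 2"])
      (simp_all add: m e f(2) K33m_dist_def K33m_E_def doubleton_eq_iff del: One_nat_def)
qed

end

section \<open>Dual polar graphs are weakly modular\<close>

context conn_graph
begin

text \<open>Among the points \<open>z\<close> through which \<open>x\<close> sees the whole
  intersection, take one nearest to \<open>v\<close>. Its gate in any member \<open>H\<close> is
  again such a point and is nearer to \<open>v\<close> unless it equals \<open>z\<close>; so
  \<open>z\<close> lies in every \<open>H\<close>. This works for infinite families.\<close>

lemma gated_Inter:
  assumes "F \<noteq> {}" "\<And>H. H \<in> F \<Longrightarrow> gated V E H" "v \<in> \<Inter>F"
  shows "gated V E (\<Inter>F)"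
proof -
  have sub: "\<Inter>F \<subseteq> V" using assms(1,2) gated_subset by blast
  have "\<exists>g\<in>\<Inter>F. \<forall>y\<in>\<Inter>F. d x g + d g y = d x y" if x: "x \<in> V" for x
  proof -
    let ?P = "\<lambda>z. z \<in> V \<and> (\<forall>y\<in>\<Inter>F. d x z + d z y = d x y)"
    have "?P x" using x by simp
    then obtain z where z: "?P z" "\<And>z'. ?P z' \<Longrightarrow> d z v \<le> d z' v"
      using ex_has_least_nat[of ?P x "\<lambda>z. d z v"] by blast
    have "z \<in> H" if H: "H \<in> F" for H
    proof -
      obtain g where g: "g \<in> H" "\<And>y. y \<in> H \<Longrightarrow> d z y = d z g + d g y"
        using gated_gate[OF assms(2)[OF H]] z(1) by blast
      have gV: "g \<in> V" using gated_subset[OF assms(2)[OF H]] g(1) by blast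
      have "?P g"
      proof (intro conjI ballI)
        fix y assume y: "y \<in> \<Inter>F"
        then have "d z y = d z g + d g y" using g(2) H by blast
        moreover have "d x z + d z y = d x y" using z y by blast
        moreover have "d x g \<le> d x z + d z g" "d x y \<le> d x g + d g y"
          using d_triangle x z(1) gV sub y by blast+
        ultimately show "d x g + d g y = d x y" by linarith
      qed (rule gV)
      then have "d z v \<le> d g v" using z(2) by blast
      moreover have "d z v = d z g + d g v" using g(2) assms(3) H by blast
      ultimately have "d z g = 0" by linarith
      then have "z = g" using d_0_iff z(1) gV by blast
      then show ?thesis using g(1) by simp
    qed
    then show ?thesis using z(1) by blast
  qed
  moreover have "g \<in> V" if "g \<in> \<Inter>F" for g using sub that by (rule subsetD)
  ultimately show ?thesis using sub unfolding gated_def interval_iff by (metis (no_types, lifting))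
qed

lemma gated_V: "gated V E V"
proof -
  have "\<forall>y\<in>V. x \<in> interval V E x y" if "x \<in> V" for x using that by (simp add: interval_iff)
  then show ?thesis unfolding gated_def by blast
qed

lemma gated_hull_gated:
  assumes "v \<in> S" "S \<subseteq> V"
  shows "gated V E (gated_hull V E S)"
  unfolding gated_hull_def
  by (rule gated_Inter[where v = v]) (use assms gated_V in auto)

lemma gated_hull_superset: "S \<subseteq> gated_hull V E S"
  unfolding gated_hull_def by blast

lemma gated_hull_subset: "gated V E H \<Longrightarrow> S \<subseteq> H \<Longrightarrow> gated_hull V E S \<subseteq> H"
  unfolding gated_hull_def by blast

lemma dist_le_induced: "dist_le (induced E H) x y k \<Longrightarrow> d x y \<le> k"
proof -
  assume "dist_le (induced E H) x y k"
  then obtain p where p: "walk (induced E H) p" "hd p = x" "last p = y" "length p \<le> Suc k"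
    unfolding dist_le_def by blast
  have "walk E p" using p(1) unfolding walk_def induced_def by auto
  then show ?thesis using dist_le_walk[of p] p by auto
qed

lemma maximal_clique_ex:
  assumes "clique E K" "K \<subseteq> V"
  shows "\<exists>M. maximal_clique V E M \<and> K \<subseteq> M"
proof -
  let ?A = "{L. K \<subseteq> L \<and> L \<subseteq> V \<and> clique E L}"
  have "\<exists>M\<in>?A. \<forall>X\<in>?A. M \<subseteq> X \<longrightarrow> X = M"
  proof (rule subset_Zorn_nonempty)
    show "?A \<noteq> {}" using assms by auto
  next
    fix C assume C: "C \<noteq> {}" "subset.chain ?A C"
    have "clique E (\<Union>C)"
      unfolding clique_def
    proof (intro ballI impI)
      fix x y assume xy: "x \<in> \<Union>C" "y \<in> \<Union>C" "x \<noteq> y"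
      then obtain L M where "L \<in> C" "x \<in> L" "M \<in> C" "y \<in> M" by blast
      then obtain L where L: "L \<in> C" "x \<in> L" "y \<in> L" using C(2) unfolding subset_chain_def by blast
      then have "clique E L" using C(2) unfolding subset_chain_def by blast
      then show "E x y" using L xy(3) unfolding clique_def by blast
    qed
    moreover have "K \<subseteq> \<Union>C" "\<Union>C \<subseteq> V" using C unfolding subset_chain_def by blast+
    ultimately show "\<Union>C \<in> ?A" by blast
  qed
  then obtain M where M: "M \<in> ?A" "\<forall>X\<in>?A. M \<subseteq> X \<longrightarrow> X = M" ..
  have M': "K \<subseteq> M" "M \<subseteq> V" "clique E M" using M(1) by auto
  have "L = M" if "M \<subseteq> L" "L \<subseteq> V" "clique E L" for L
  proof -
    have "L \<in> ?A" using M'(1) that by simp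
    then show ?thesis using M(2) that(1) by simp
  qed
  then have "maximal_clique V E M" unfolding maximal_clique_def using M' by simp
  then show ?thesis using M'(1) by blast
qed

context
  assumes dp: "dual_polar V E"
begin

lemma dp_hull:
  assumes "d u v = 2" "u \<in> V" "v \<in> V"
  obtains H where "gated V E H" "u \<in> H" "v \<in> H" "\<And>x y. x \<in> H \<Longrightarrow> y \<in> H \<Longrightarrow> d x y \<le> 2"
proof -
  let ?H = "gated_hull V E {u, v}"
  have "has_diameter E ?H 2" using dp assms unfolding dual_polar_def axiom_A34_def by blast
  then have "\<And>x y. x \<in> ?H \<Longrightarrow> y \<in> ?H \<Longrightarrow> d x y \<le> 2"
    unfolding has_diameter_def using dist_le_induced by blast
  then show thesis
    using that[of ?H] gated_hull_gated[of u "{u, v}"] gated_hull_superset[of "{u, v}"] assms by blast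
qed

lemma dp_clique:
  assumes "clique E K" "K \<subseteq> V"
  obtains M where "gated V E M" "K \<subseteq> M" "clique E M"
proof -
  obtain M where M: "maximal_clique V E M" "K \<subseteq> M" using maximal_clique_ex[OF assms] by auto
  have "gated V E M" using dp M(1) by (simp add: dual_polar_def axiom_A1_def)
  moreover have "clique E M" using M(1) by (simp add: maximal_clique_def)
  ultimately show thesis using that M(2) by simp
qed

text \<open>A maximal clique through \<open>a\<close>, \<open>b\<close>, \<open>c\<close> misses
  \<open>e\<close>, and the gate of \<open>e\<close> in it would have to be both \<open>b\<close>
  and \<open>c\<close>.\<close>

lemma dp_no_K4m: "\<not> contains_induced V E K4m_V K4m_E"
proof
  assume "contains_induced V E K4m_V K4m_E"
  then obtain a b c e where k: "{a, b, c, e} \<subseteq> V" "E a b" "E a c" "E b c" "E b e" "E c e" "a \<noteq> e" "\<not> E a e"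
    by (rule contains_K4mD)
  have "clique E {a, b, c}" using k E_sym unfolding clique_def by blast
  moreover have "{a, b, c} \<subseteq> V" using k(1) by simp
  ultimately obtain M where M: "gated V E M" "{a, b, c} \<subseteq> M" "clique E M" by (rule dp_clique)
  have e: "e \<notin> M" using M k unfolding clique_def by auto
  obtain g where g: "g \<in> M" "\<And>y. y \<in> M \<Longrightarrow> d e y = d e g + d g y"
    using gated_gate[OF M(1)] k by blast
  have V: "g \<in> V" "b \<in> V" "c \<in> V" "e \<in> V" using k gated_subset M(1) g(1) by auto
  have "d e g \<noteq> 0" using d_0_iff V e g(1) by metis
  moreover have "d e b = 1" "d e c = 1" using d_edge k E_sym by auto
  moreover have "d e b = d e g + d g b" "d e c = d e g + d g c" using g(2) M(2) by auto
  ultimately have "d g b = 0" "d g c = 0" by linarith+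
  then have "b = c" using d_0_iff V by metis
  then show False using k by simp
qed

text \<open>The hull of \<open>p\<close>, \<open>p'\<close> absorbs common neighbours at distance 2,
  first \<open>s\<close>, \<open>q\<close>, \<open>q'\<close> and then \<open>t\<close>, but has
  diameter 2.\<close>

lemma dp_no_K33m: "\<not> contains_isometric V E K33m_V K33m_E"
proof
  assume "contains_isometric V E K33m_V K33m_E"
  then obtain s p p' t q q' where k: "E s p" "E s p'" "E t q" "E t q'" "E p q" "E p q'" "E p' q" "E p' q'"
    "d s t = 3" "d p p' = 2" "d q q' = 2"
    by (rule contains_K33mD)
  obtain H where H: "gated V E H" "p \<in> H" "p' \<in> H" "\<And>x y. x \<in> H \<Longrightarrow> y \<in> H \<Longrightarrow> d x y \<le> 2"
    using dp_hull[OF k(10)] E_V[OF k(1)] E_V[OF k(2)] by metis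
  have "s \<in> H" "q \<in> H" "q' \<in> H"
    using gated_common_nb[OF H(1-3) k(10)] k E_sym by auto
  then have "t \<in> H" using gated_common_nb[OF H(1) _ _ k(11)] k E_sym by blast
  then have "d s t \<le> 2" using H(4) \<open>s \<in> H\<close> by blast
  then show False using k by simp
qed

text \<open>At distance 2, (A5) turns a middle vertex \<open>x\<close> into an opposite one
  \<open>y\<close>, and \<open>u x v y\<close> is the required square.\<close>

lemma dp_thick: "thick V E"
  unfolding thick_def
proof (intro ballI impI)
  fix u v assume uv: "u \<in> V" "v \<in> V" "d u v = 2"
  obtain x where x: "E u x" "E x v" "u \<noteq> v" "\<not> E u v" using d_2E[OF uv(3,1,2)] .
  have ix: "d u x = 1" "d x v = 1" using x d_edge by auto
  then have xi: "x \<in> interval V E u v" using uv E_V x unfolding interval_iff by simp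
  have "\<forall>x. \<not> E u v \<and> E u x \<and> x \<in> interval V E u v \<longrightarrow>
      (\<exists>y. E v y \<and> y \<in> interval V E u v \<and>
           d u v = d x y \<and> d u v = d u y + 1 \<and> d u v = d x v + 1)"
    using dp uv(1,2) unfolding dual_polar_def axiom_A5_def by blast
  then obtain y where y: "E v y" "y \<in> interval V E u v" "d x y = 2" "d u y = 1"
    using x(1,4) xi uv(3) by fastforce
  have V: "x \<in> V" "y \<in> V" using E_V x y by auto
  then have "E u y" "\<not> E x y" "x \<noteq> y" using d_1 uv y d_edge[of x y] by auto
  then have "induced_4cycle E u x v y"
    using x y E_sym[of u y] unfolding induced_4cycle_def by auto
  moreover have "{u, x, v, y} \<subseteq> interval V E u v" using xi y uv by (auto simp: interval_iff)
  ultimately show "\<exists>a b c e. {a, b, c, e} \<subseteq> interval V E u v \<and> induced_4cycle E a b c e" by blast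
qed

text \<open>The vertex sought is the gate of \<open>u\<close>, in a maximal clique through
  \<open>v\<close>, \<open>w\<close> or in the hull of \<open>v\<close>, \<open>w\<close>, which
  contains \<open>z\<close>. Equal distances from \<open>u\<close> exclude the gates
  \<open>v\<close> and \<open>w\<close>; in the hull, \<open>d g z \<le> 2\<close> leaves only
  \<open>d g v = 1\<close>.\<close>

lemma dp_weakly_modular: "weakly_modular V E"
  unfolding weakly_modular_def
proof (intro ballI conjI impI, goal_cases)
  case (1 u v w)
  then have vw: "E v w" and eq: "d u v = d u w" by auto
  have "clique E {v, w}" using vw E_sym unfolding clique_def by blast
  moreover have "{v, w} \<subseteq> V" using 1(2,3) by simp
  ultimately obtain M where M: "gated V E M" "{v, w} \<subseteq> M" "clique E M" by (rule dp_clique)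
  obtain g where g: "g \<in> M" "\<And>y. y \<in> M \<Longrightarrow> d u y = d u g + d g y"
    using gated_gate[OF M(1) 1(1)] by blast
  have gV: "g \<in> V" using gated_subset M(1) g(1) by blast
  have e: "d u v = d u g + d g v" "d u w = d u g + d g w" using g(2) M(2) by auto
  have "g \<noteq> v" "g \<noteq> w" using e eq d_edge[OF vw] d_edge[OF E_sym[OF vw]] by auto
  then have a: "E g v" "E g w" using M g(1) unfolding clique_def by auto
  then have "d u g = d u v - 1" using e(1) d_edge by simp
  then show ?case using a by blast
next
  case (2 u v w z)
  then have k: "E v z" "E w z" "d v w = 2" "d u v = d u w" "d u z = d u v + 1" by auto
  obtain H where H: "gated V E H" "v \<in> H" "w \<in> H" "\<And>x y. x \<in> H \<Longrightarrow> y \<in> H \<Longrightarrow> d x y \<le> 2"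
    using dp_hull[OF k(3) 2(2,3)] by metis
  have zH: "z \<in> H" using gated_common_nb[OF H(1-3) k(3)] k E_sym by blast
  obtain g where g: "g \<in> H" "\<And>y. y \<in> H \<Longrightarrow> d u y = d u g + d g y"
    using gated_gate[OF H(1) 2(1)] by blast
  have gV: "g \<in> V" using gated_subset H(1) g(1) by blast
  have e: "d u v = d u g + d g v" "d u w = d u g + d g w" "d u z = d u g + d g z"
    using g(2)[OF H(2)] g(2)[OF H(3)] g(2)[OF zH] .
  have "d g z \<le> 2" using H(4) g(1) zH by blast
  moreover have "d g v \<noteq> 0" using e k d_0_iff[OF gV 2(2)] by auto
  ultimately have one: "d g v = 1" using e k by linarith
  then have "d g w = 1" using e k by simp
  then have "E g v" "E g w" using one d_1 gV 2 by auto
  moreover have "d u g = d u v - 1" using e one by simp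
  ultimately show ?case by blast
qed

end

end

section \<open>Quads in thick weakly modular graphs\<close>

text \<open>The hypotheses in working form: forbidden subgraphs become closure rules, and thickness
  becomes a second common neighbour.\<close>

locale thick_swm_graph = conn_graph V E for V :: "'a set" and E +
  assumes TC: "u \<in> V \<Longrightarrow> E v w \<Longrightarrow> d u v = d u w \<Longrightarrow> \<exists>x. E x v \<and> E x w \<and> Suc (d u x) = d u v"
    and QC: "u \<in> V \<Longrightarrow> E v z \<Longrightarrow> E w z \<Longrightarrow> v \<noteq> w \<Longrightarrow> d u z = Suc (d u v) \<Longrightarrow> d u z = Suc (d u w)
      \<Longrightarrow> \<exists>x. E x v \<and> E x w \<and> Suc (d u x) = d u v"
    and K4: "E a b \<Longrightarrow> E a c \<Longrightarrow> E b c \<Longrightarrow> E b x \<Longrightarrow> E c x \<Longrightarrow> a = x \<or> E a x"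
    and K33: "E s p \<Longrightarrow> E s p' \<Longrightarrow> E t q \<Longrightarrow> E t q' \<Longrightarrow> E p q \<Longrightarrow> E p q' \<Longrightarrow> E p' q \<Longrightarrow> E p' q'
      \<Longrightarrow> p \<noteq> p' \<Longrightarrow> q \<noteq> q' \<Longrightarrow> \<not> E p p' \<Longrightarrow> \<not> E q q' \<Longrightarrow> d s t \<le> 2"
    and thick2: "E u a \<Longrightarrow> E a v \<Longrightarrow> u \<noteq> v \<Longrightarrow> \<not> E u v \<Longrightarrow> \<exists>b. E u b \<and> E b v \<and> b \<noteq> a"
begin

lemma common_nbs:
  "E u a \<Longrightarrow> E a v \<Longrightarrow> E u b \<Longrightarrow> E b v \<Longrightarrow> u \<noteq> v \<Longrightarrow> \<not> E u v \<Longrightarrow> \<not> E a b"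
  using K4[of u a b v] by blast

lemma TC1: "E v w \<Longrightarrow> u \<in> V \<Longrightarrow> d u v = 2 \<Longrightarrow> d u w = 2 \<Longrightarrow> \<exists>x. E x v \<and> E x w \<and> E u x"
  using TC[of u v w] d_1[of u] E_V by (metis One_nat_def Suc_1 nat.inject)

lemma d2D: "d u v = 2 \<Longrightarrow> u \<noteq> v \<and> \<not> E u v"
  using d_edge[of u v] by auto

text \<open>For neighbours of a vertex \<open>u\<close>, \<open>col\<close> says that they lie on one line (maximal clique)
  through \<open>u\<close>, and \<open>near u c v\<close> that \<open>v\<close> is adjacent to a point other than \<open>u\<close> of the line
  through \<open>u\<close> and \<open>c\<close>.\<close>

definition col :: "'a \<Rightarrow> 'a \<Rightarrow> bool" where
  "col x y \<longleftrightarrow> x = y \<or> E x y"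

definition near :: "'a \<Rightarrow> 'a \<Rightarrow> 'a \<Rightarrow> bool" where
  "near u c v \<longleftrightarrow> (\<exists>x. E u x \<and> col x c \<and> E x v)"

definition same :: "'a \<Rightarrow> 'a \<Rightarrow> 'a \<Rightarrow> bool" where
  "same u v v' \<longleftrightarrow> (\<forall>c. E u c \<longrightarrow> (near u c v \<longleftrightarrow> near u c v'))"

lemma col_refl [simp]: "col x x"
  by (simp add: col_def)

lemma col_sym: "col x y \<Longrightarrow> col y x"
  using E_sym unfolding col_def by blast

text \<open>Excluding \<open>K4\<close> minus an edge makes the lines through \<open>u\<close>
  partition its neighbours.\<close>

lemma col_trans: "E u x \<Longrightarrow> E u y \<Longrightarrow> E u z \<Longrightarrow> col x y \<Longrightarrow> col y z \<Longrightarrow> col x z"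
  using K4[of x u y z] E_sym unfolding col_def by blast

lemma near_col: "E u c \<Longrightarrow> E u c' \<Longrightarrow> col c c' \<Longrightarrow> near u c v \<Longrightarrow> near u c' v"
  using col_trans unfolding near_def by blast

lemma same_trans: "same u v v' \<Longrightarrow> same u v' v'' \<Longrightarrow> same u v v''"
  unfolding same_def by blast

lemma near_self: "E u x \<Longrightarrow> E x v \<Longrightarrow> near u x v"
  unfolding near_def by auto

text \<open>If \<open>d v x = 2\<close>, the triangle condition at \<open>v\<close> for the edge
  \<open>u x\<close> gives a neighbour of \<open>v\<close> on the line through \<open>u\<close> and
  \<open>x\<close>.\<close>

lemma near_dist:
  assumes "d u v = 2" "E u x" "d v x \<le> 2" "v \<in> V"
  shows "near u x v"
proof -
  have V: "u \<in> V" "x \<in> V" using E_V assms by auto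
  show ?thesis
  proof (cases rule: d_le_2_cases[OF assms(4) V(2) assms(3)])
    case 1
    then show ?thesis using assms d_edge[OF assms(2)] by simp
  next
    case 2
    then show ?thesis using near_self assms E_sym by blast
  next
    case 3
    obtain y where "E y u" "E y x" "E v y"
      using TC1[OF assms(2,4)] 3 assms d_sym[OF V(1) assms(4)] by auto
    then show ?thesis using E_sym unfolding near_def col_def by blast
  qed
qed

lemma near_half:
  assumes "d u v' = 2" "v' \<in> V" "E u c" "near u c v"
    and "\<And>x. E u x \<Longrightarrow> E x v \<Longrightarrow> d v' x \<le> 2"
  shows "near u c v'"
proof -
  obtain x where x: "E u x" "col x c" "E x v" using assms(4) near_def by blast
  then have "near u x v'" using near_dist assms by blast
  then show ?thesis using near_col x assms(3) by blast
qed

lemma same_adj: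
  assumes "E v v'" "d u v = 2" "d u v' = 2"
  shows "same u v v'"
proof -
  have "near u c w'" if "E u c" "near u c w" "E w w'" "d u w' = 2" for c w w'
  proof (rule near_half[OF that(4) _ that(1,2)])
    show "w' \<in> V" using E_V that by blast
    show "d w' x \<le> 2" if "E u x" "E x w" for x
      using d_path2[of w' w x] \<open>E w w'\<close> that E_sym by blast
  qed
  then show ?thesis using assms E_sym unfolding same_def by blast
qed

text \<open>For a common neighbour \<open>x\<close> of \<open>u\<close> and \<open>v\<close>, the
  sides \<open>a\<close>, \<open>b\<close>, \<open>x\<close> and \<open>u\<close>, \<open>v\<close>,
  \<open>v'\<close> span \<open>K33\<close> up to the edge \<open>x v'\<close>; \<open>K33\<close>
  therefore gives \<open>d v' x \<le> 2\<close>.\<close>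

lemma same_common:
  assumes "E u a" "E u b" "a \<noteq> b" "E a v" "E b v" "E a v'" "E b v'" "d u v = 2" "d u v' = 2"
  shows "same u v v'"
proof -
  have half: "near u c w'" if w: "E u c" "near u c w" "E a w" "E b w" "E a w'" "E b w'" "d u w = 2" "d u w' = 2" for c w w'
  proof (rule near_half[OF w(8) _ w(1,2)])
    show "w' \<in> V" using E_V w by blast
    have n: "u \<noteq> w" "\<not> E u w" using d2D w by auto
    have ab: "\<not> E a b" using common_nbs[OF assms(1) w(3) assms(2) w(4) n] .
    show "d w' x \<le> 2" if "E u x" "E x w" for x
      using K33[of w' a b x u w] w that assms ab n E_sym by blast
  qed
  show ?thesis using half assms unfolding same_def by blast
qed

text \<open>If \<open>v\<close>, \<open>v'\<close> are at distance 2, the triangle condition at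
  \<open>v'\<close> for the edge \<open>a v\<close> gives a vertex \<open>w\<close> adjacent to both
  with \<open>d u w = 2\<close>, and \<open>same_adj\<close> is used twice.\<close>

lemma same_share_point:
  assumes "E u a" "E u a'" "E u b" "E a a'" "E a v" "E b v" "E a' v'" "E b v'" "d u v = 2" "d u v' = 2"
  shows "same u v v'"
proof -
  have V: "u \<in> V" "a \<in> V" "v \<in> V" "v' \<in> V" using E_V assms by auto
  have n: "u \<noteq> v" "\<not> E u v" "u \<noteq> v'" "\<not> E u v'" using d2D assms by auto
  have va: "\<not> E v' a" using common_nbs[OF assms(1) _ assms(2,7) n(3,4)] assms(4) E_sym by blast
  have "v' \<noteq> a" using n assms by auto
  then have d1: "d v' a = 2" using d_2I[of v' a' a] va assms E_sym by blast
  have d2: "d v' v \<le> 2" using d_path2[of v' b v] assms E_sym by blast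
  show ?thesis
  proof (cases rule: d_le_2_cases[OF V(4,3) d2])
    case 1
    then show ?thesis by (simp add: same_def)
  next
    case 2
    then show ?thesis using same_adj E_sym assms by blast
  next
    case 3
    obtain w where w: "E w a" "E w v" "E v' w" using TC1[OF assms(5) V(4) d1 3] by blast
    have "\<not> E u w" using common_nbs[OF assms(1,5) _ w(2) n(1,2)] w E_sym by blast
    moreover have "w \<noteq> u" using w n by auto
    ultimately have dw: "d u w = 2" using d_2I[of u a w] assms w E_sym by blast
    have "same u v w" using same_adj[of v w u] w E_sym assms dw by blast
    moreover have "same u w v'" using same_adj[of w v' u] w E_sym assms dw by blast
    ultimately show ?thesis by (rule same_trans)
  qed
qed

lemma same_share:
  assumes uab: "E u a" "E u b" "\<not> col a b"
    and v: "d u v = 2" "near u a v" "near u b v"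
    and v': "d u v' = 2" "near u a v'" "near u b v'"
  shows "same u v v'"
proof -
  obtain a1 where a1: "E u a1" "col a1 a" "E a1 v" using v near_def by blast
  obtain b1 where b1: "E u b1" "col b1 b" "E b1 v" using v near_def by blast
  obtain a2 where a2: "E u a2" "col a2 a" "E a2 v'" using v' near_def by blast
  obtain b2 where b2: "E u b2" "col b2 b" "E b2 v'" using v' near_def by blast
  have dif: "\<not> col x y" if "E u x" "E u y" "col x a" "col y b" for x y
    using col_trans[of u a x b] col_trans[of u x y b] col_sym[of x a] that uab by blast
  have ca: "a1 = a2 \<or> E a1 a2" using col_trans[of u a1 a a2] col_sym a1 a2 uab unfolding col_def by blast
  have cb: "b1 = b2 \<or> E b1 b2" using col_trans[of u b1 b b2] col_sym b1 b2 uab unfolding col_def by blast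
  have ne: "a1 \<noteq> b1" using dif[OF a1(1) b1(1) a1(2) b1(2)] unfolding col_def by blast
  show ?thesis
  proof (cases "a1 = a2"; cases "b1 = b2")
    assume "a1 = a2" "b1 = b2"
    then show ?thesis using same_common[OF a1(1) b1(1) ne] a1 b1 a2 b2 v v' by blast
  next
    assume "a1 = a2" "b1 \<noteq> b2"
    then show ?thesis using same_share_point[of u b1 b2 a1 v v'] a1 b1 a2 b2 v v' cb by blast
  next
    assume "a1 \<noteq> a2" "b1 = b2"
    then show ?thesis using same_share_point[of u a1 a2 b1 v v'] a1 b1 a2 b2 v v' ca by blast
  next
    \<comment> \<open>Thickness gives \<open>w\<close> opposite \<open>u\<close> over
      \<open>a2\<close> and \<open>b1\<close>; it shares \<open>b1\<close> with \<open>v\<close> and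
      \<open>a2\<close> with \<open>v'\<close>.\<close>
    assume n: "a1 \<noteq> a2" "b1 \<noteq> b2"
    have n': "a2 \<noteq> b1" "\<not> E a2 b1" using dif[OF a2(1) b1(1) a2(2) b1(2)] unfolding col_def by auto
    obtain w where w: "E a2 w" "E w b1" "w \<noteq> u"
      using thick2[OF E_sym[OF a2(1)] b1(1) n'] by blast
    have "\<not> E u w" using common_nbs[OF E_sym[OF a2(1)] b1(1) w(1,2) n'] .
    then have dw: "d u w = 2" using d_2I[of u a2 w] a2 w by blast
    have "same u v w" using same_share_point[of u a1 a2 b1 v w] a1 a2 b1 w E_sym n ca dw v by blast
    moreover have "same u w v'"
      using same_share_point[of u b1 b2 a2 w v'] a2 b1 b2 w E_sym n cb dw v' by blast
    ultimately show ?thesis by (rule same_trans)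
  qed
qed

section \<open>Diameter and gatedness of the quads\<close>

text \<open>The gated hull of two vertices at distance 2 will turn out to be contained in this set.\<close>

definition quad_hull :: "'a \<Rightarrow> 'a \<Rightarrow> 'a set" where
  "quad_hull u v = {x \<in> V. x = u \<or> E u x \<and> near u x v \<or> d u x = 2 \<and> same u x v}"

lemma quad_hull_cases:
  assumes "x \<in> quad_hull u v"
  obtains "x = u" | "E u x" "near u x v" | "d u x = 2" "same u x v" "x \<in> V"
  using assms unfolding quad_hull_def by blast

lemma quad_two:
  assumes "d u v = 2" "u \<in> V" "v \<in> V"
  obtains a b where "E u a" "near u a v" "E u b" "near u b v" "\<not> col a b"
proof -
  obtain a where a: "E u a" "E a v" "u \<noteq> v" "\<not> E u v" using d_2E[OF assms] .
  then obtain b where b: "E u b" "E b v" "b \<noteq> a" using thick2 by blast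
  have "\<not> E a b" using common_nbs[OF a(1,2) b(1,2) a(3,4)] .
  then show thesis using that[of a b] a b near_self unfolding col_def by blast
qed

lemma quad_near:
  assumes "same u x v" "E u c" "near u c v"
  obtains p where "E u p" "col p c" "E p x"
  using assms unfolding same_def near_def by blast

text \<open>If \<open>x\<close> and \<open>y\<close> were farther apart, their contact points
  \<open>p\<close>, \<open>q\<close> and \<open>p'\<close>, \<open>q'\<close> on two lines would
  differ. Two triangle conditions then give \<open>r\<close> adjacent to \<open>p\<close>,
  \<open>q'\<close>, \<open>y\<close> and \<open>s\<close> adjacent to \<open>r\<close>,
  \<open>q'\<close>, \<open>x\<close>, and \<open>K4\<close> brings \<open>s\<close> to
  \<open>y\<close> or next to it.\<close>

lemma quad_hull_sphere_diam:
  assumes uv: "d u v = 2" "u \<in> V" "v \<in> V"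
    and x: "d u x = 2" "same u x v" "x \<in> V" and y: "d u y = 2" "same u y v" "y \<in> V"
  shows "d x y \<le> 2"
proof (rule ccontr)
  assume "\<not> d x y \<le> 2"
  then have far: False if "d x y \<le> 2" using that by simp
  obtain a b where ab: "E u a" "near u a v" "E u b" "near u b v" "\<not> col a b"
    using quad_two[OF uv] .
  obtain p where p: "E u p" "col p a" "E p x" using quad_near[OF x(2) ab(1,2)] .
  obtain p' where p': "E u p'" "col p' b" "E p' x" using quad_near[OF x(2) ab(3,4)] .
  obtain q where q: "E u q" "col q a" "E q y" using quad_near[OF y(2) ab(1,2)] .
  obtain q' where q': "E u q'" "col q' b" "E q' y" using quad_near[OF y(2) ab(3,4)] .
  have V: "p \<in> V" using E_V p by blast
  have "p \<noteq> q" using far d_path2[of x p y] p q E_sym by blast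
  then have pq: "E p q" using col_trans[of u p a q] col_sym p q ab unfolding col_def by blast
  have "p' \<noteq> q'" using far d_path2[of x p' y] p' q' E_sym by blast
  then have pq': "E p' q'" using col_trans[of u p' b q'] col_sym p' q' ab unfolding col_def by blast
  have "\<not> col p q'"
    using col_trans[of u a p b] col_trans[of u p q' b] col_sym[of p a] p q' ab by blast
  then have 1: "d p q' = 2" using d_2I[of p u q'] p q' E_sym unfolding col_def by blast
  have "\<not> E p y" using far d_path2[of x p y] p E_sym by blast
  moreover have "p \<noteq> y" using p d2D[OF y(1)] by blast
  ultimately have 2: "d p y = 2" using d_2I[of p q y] pq q by blast
  obtain r where r: "E r q'" "E r y" "E p r" using TC1[OF q'(3) V 1 2] by blast
  have "x \<noteq> r" using far r d_edge by auto
  moreover have "\<not> E x r" using far r d_path2 by blast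
  ultimately have 3: "d x r = 2" using d_2I[of x p r] p r E_sym by blast
  have "\<not> E x q'" using far d_path2[of x q' y] q' by blast
  moreover have "x \<noteq> q'" using q' d2D[OF x(1)] by blast
  ultimately have 4: "d x q' = 2" using d_2I[of x p' q'] p' pq' E_sym by blast
  obtain s where s: "E s r" "E s q'" "E x s" using TC1[OF r(1) x(3) 3 4] by blast
  have "y = s \<or> E y s" using K4[of y r q' s] r q' s E_sym by blast
  then show False using far d_edge[of x y] d_path2[of x s y] s E_sym by auto
qed

lemma quad_hull_diam:
  assumes uv: "d u v = 2" "u \<in> V" "v \<in> V" and "x \<in> quad_hull u v" "y \<in> quad_hull u v"
  shows "d x y \<le> 2"
proof -
  have line_sphere: "d c y \<le> 2" if h: "E u c" "near u c v" "d u y = 2" "same u y v" for c y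
  proof -
    obtain p where "E u p" "col p c" "E p y" using quad_near[OF h(4,1,2)] .
    then show ?thesis using d_path2[of c p y] d_edge[of c y] E_sym unfolding col_def by auto
  qed
  have sym: "d x y = d y x" using d_sym assms(4,5) unfolding quad_hull_def by blast
  from assms(4) show ?thesis
  proof (cases rule: quad_hull_cases)
    case 1
    from assms(5) show ?thesis by (cases rule: quad_hull_cases) (use 1 d_edge[of u y] in auto)
  next
    case x: 2
    from assms(5) show ?thesis
      by (cases rule: quad_hull_cases)
        (use x line_sphere d_edge[of x u] d_path2[of x u y] E_sym[of u x] in auto)
  next
    case x: 3
    from assms(5) show ?thesis
    proof (cases rule: quad_hull_cases)
      case 1
      then show ?thesis using x sym by simp
    next
      case 2
      then show ?thesis using x sym line_sphere by simp
    next
      case 3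
      then show ?thesis using quad_hull_sphere_diam[OF uv x 3] by simp
    qed
  qed
qed

lemma quad_hull_nb_sphere:
  assumes "u \<in> V" "d u q = 2" "same u q v" "E z q" "d u z \<le> 2"
  shows "z \<in> quad_hull u v"
proof -
  have V: "z \<in> V" using E_V assms by blast
  show ?thesis
  proof (cases rule: d_le_2_cases[OF assms(1) V assms(5)])
    case 1
    then show ?thesis using V by (simp add: quad_hull_def)
  next
    case 2
    then have "near u z v" using near_self assms(3,4) unfolding same_def by blast
    then show ?thesis using V 2 by (simp add: quad_hull_def)
  next
    case 3
    have "same u z v" using same_trans[OF same_adj[OF assms(4) 3 assms(2)] assms(3)] .
    then show ?thesis using V 3 by (simp add: quad_hull_def)
  qed
qed

lemma quad_hull_nb_line:
  assumes "E u c" "near u c v" "E u z" "E z c"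
  shows "z \<in> quad_hull u v"
  using near_col[of u c z v] assms E_sym E_V unfolding quad_hull_def col_def by blast

text \<open>If \<open>d u z = 3\<close>, the case of adjacent \<open>p\<close>, \<open>q\<close> is
  settled by \<open>K4\<close>. Otherwise the quadrangle condition gives \<open>r\<close> below
  both. On a line avoiding \<open>r\<close>, \<open>p\<close> and \<open>q\<close> either touch the
  same point, which contradicts \<open>K33\<close>, or two adjacent points, whose common neighbour
  next to \<open>z\<close> is at most one step from \<open>u\<close>.\<close>

lemma quad_hull_sphere_nb:
  assumes uv: "d u v = 2" "u \<in> V" "v \<in> V"
    and p: "d u p = 2" "same u p v" and q: "d u q = 2" "same u q v"
    and z: "E z p" "E z q" "E p q \<or> d p q = 2"
  shows "d u z \<le> 2"
proof (rule ccontr)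
  assume h: "\<not> d u z \<le> 2"
  have zV: "z \<in> V" and pV: "p \<in> V" using E_V z by auto
  have dz: "d u z = 3" using h d_nb[OF uv(2), of p z] z p E_sym by fastforce
  have no2: False if "E u x" "E x z" for x using h d_path2 that by blast
  show False
  proof (cases "E p q")
    case True
    then obtain r where r: "E r p" "E r q" "E u r" using TC1[OF True uv(2)] p q by blast
    have "r = z \<or> E r z" using K4[of r p q z] r True z E_sym by blast
    then show ?thesis using no2 r h d_edge by fastforce
  next
    case False
    then have "d p q = 2" using z by blast
    then have pq: "p \<noteq> q" by auto
    obtain r where r: "E r p" "E r q" "Suc (d u r) = 2"
      using QC[of u p z q] uv(2) z pq p q dz E_sym by fastforce
    have rV: "r \<in> V" using E_V r by blast
    have ur: "E u r" using d_1[OF uv(2) rV] r by simp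
    obtain a where a: "E u a" "near u a v" "\<not> col a r"
      using quad_two[OF uv] col_trans[of u _ r] col_sym ur by metis
    obtain p' where p': "E u p'" "col p' a" "E p' p" using quad_near[OF p(2) a(1,2)] .
    obtain q' where q': "E u q'" "col q' a" "E q' q" using quad_near[OF q(2) a(1,2)] .
    have "\<not> col r p'" using col_trans[of u a p' r] col_sym p' a ur by blast
    then have rp: "r \<noteq> p'" "\<not> E r p'" unfolding col_def by auto
    show ?thesis
    proof (cases "p' = q'")
      case True
      then show ?thesis using K33[of u r p' z p q] ur p' q' z r rp pq False h by blast
    next
      case neq: False
      then have e: "E p' q'" using col_trans[of u p' a q'] col_sym p' q' a unfolding col_def by blast
      have "z \<noteq> p'" "z \<noteq> q'" using p' q' h d_edge by auto
      moreover have "\<not> E z p'" "\<not> E z q'" using no2 p' q' E_sym by blast+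
      ultimately have "d z p' = 2" "d z q' = 2"
        using d_2I[of z p p'] d_2I[of z q q'] z p' q' E_sym by blast+
      then obtain s where s: "E s p'" "E s q'" "E z s" using TC1[OF e zV] by blast
      have "s = u \<or> E s u" using K4[of s p' q' u] s e p' q' E_sym by blast
      then show ?thesis using no2 s E_sym h d_edge[of z u] d_sym[OF uv(2) zV] by fastforce
    qed
  qed
qed

lemma quad_hull_closed:
  assumes uv: "d u v = 2" "u \<in> V" "v \<in> V"
    and xy: "x \<in> quad_hull u v" "y \<in> quad_hull u v" "E x y \<or> d x y = 2"
    and z: "E z x" "E z y"
  shows "z \<in> quad_hull u v"
proof -
  have zV: "z \<in> V" using E_V z by blast
  have sphere: ?thesis if "d u q = 2" "same u q v" "E z q" "d u z \<le> 2" for q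
    using quad_hull_nb_sphere[OF uv(2) that] .
  have le1: "d u z \<le> 2" if "E z p" "E u p" for p
    using d_path2 that E_sym by blast
  have dyx: "E y x \<or> d y x = 2" using xy E_sym d_sym E_V[OF z(1)] E_V[OF z(2)] by metis
  from xy(1) show ?thesis
  proof (cases rule: quad_hull_cases)
    case x: 1
    from xy(2) show ?thesis
    proof (cases rule: quad_hull_cases)
      case 1
      then show ?thesis using x xy(3) by simp
    next
      case 2
      then show ?thesis using quad_hull_nb_line z x E_sym by blast
    next
      case 3
      then show ?thesis using sphere z x d_edge[OF E_sym[OF z(1)]] by simp
    qed
  next
    case x: 2
    from xy(2) show ?thesis
    proof (cases rule: quad_hull_cases)
      case 1
      then show ?thesis using quad_hull_nb_line[OF x] z E_sym by blast
    next
      case y: 2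
      show ?thesis
      proof (cases "E x y")
        case True
        have "u = z \<or> E u z" using K4[of u x y z] x y z True E_sym by blast
        then show ?thesis using quad_hull_nb_line[OF x] z zV unfolding quad_hull_def by blast
      next
        case False
        then have "x \<noteq> y" using xy(3) by auto
        then have "\<not> E u z" using common_nbs[of x u y z] x y z False E_sym by blast
        show ?thesis
        proof (cases "z = u")
          case True
          then show ?thesis using zV unfolding quad_hull_def by blast
        next
          case n: False
          then have dz: "d u z = 2" using d_2I[of u x z] x z \<open>\<not> E u z\<close> E_sym by blast
          \<comment> \<open>\<open>z\<close> is near the two distinct lines of \<open>x\<close> and
            \<open>y\<close>, just as \<open>v\<close> is; this suffices by
            \<open>same_share\<close>.\<close>
          have "same u z v"
            using same_share[of u x y z v] x y z near_self E_sym dz uv False \<open>x \<noteq> y\<close>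
            unfolding col_def by blast
          then show ?thesis using dz zV unfolding quad_hull_def by blast
        qed
      qed
    next
      case 3
      then show ?thesis using sphere[OF 3(1,2)] le1 z x by blast
    qed
  next
    case x: 3
    from xy(2) show ?thesis
    proof (cases rule: quad_hull_cases)
      case 1
      then show ?thesis using sphere[OF x(1,2) z(1)] z d_edge[OF E_sym[OF z(2)]] by simp
    next
      case 2
      then show ?thesis using sphere[OF x(1,2)] le1 z by blast
    next
      case 3
      then show ?thesis
        using sphere[OF x(1,2) z(1)] quad_hull_sphere_nb[OF uv x(1,2) 3(1,2) z xy(3)] by blast
    qed
  qed
qed

text \<open>A point \<open>g\<close> of \<open>H\<close> nearest to \<open>x\<close> is the gate. A
  point of \<open>H\<close> at distance 1 or 2 from \<open>g\<close> that is too close to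
  \<open>x\<close> would, by weak modularity and closure, put a point still nearer than
  \<open>g\<close> into \<open>H\<close>.\<close>

lemma gatedI_diam2:
  assumes H: "H \<subseteq> V" "H \<noteq> {}"
    and diam: "\<And>x y. x \<in> H \<Longrightarrow> y \<in> H \<Longrightarrow> d x y \<le> 2"
    and closed: "\<And>x y z. x \<in> H \<Longrightarrow> y \<in> H \<Longrightarrow> E x y \<or> d x y = 2 \<Longrightarrow> E z x \<Longrightarrow> E z y \<Longrightarrow> z \<in> H"
  shows "gated V E H"
proof -
  have "\<exists>g\<in>H. \<forall>y\<in>H. g \<in> interval V E x y" if x: "x \<in> V" for x
  proof -
    obtain h where "h \<in> H" using H by blast
    then obtain g where g: "g \<in> H" "\<And>y. y \<in> H \<Longrightarrow> d x g \<le> d x y"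
      using ex_has_least_nat[of "\<lambda>y. y \<in> H" h "d x"] by blast
    have gV: "g \<in> V" using g H by blast
    have out: "z \<notin> H" if "Suc (d x z) = d x g" for z using g(2)[of z] that by auto
    have adj: "d x y = Suc (d x g)" if y: "y \<in> H" "E g y" for y
    proof -
      have "d x y \<noteq> d x g"
        using TC[OF x y(2)] closed[OF g(1) y(1)] y(2) out by metis
      then show ?thesis using g(2)[OF y(1)] d_nb[OF x y(2)] by simp
    qed
    have two: "d x y = d x g + 2" if y: "y \<in> H" "d g y = 2" for y
    proof -
      have yV: "y \<in> V" using y H by blast
      obtain t where t: "E g t" "E t y" "g \<noteq> y" "\<not> E g y" using d_2E[OF y(2) gV yV] .
      have tH: "t \<in> H" using closed[OF g(1) y(1), of t] y t E_sym by blast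
      have dt: "d x t = Suc (d x g)" using adj tH t by blast
      have "d x y \<noteq> d x g"
      proof
        assume e: "d x y = d x g"
        then obtain z where z: "E z g" "E z y" "Suc (d x z) = d x g"
          using QC[OF x t(1) E_sym[OF t(2)] t(3)] dt by auto
        then show False using closed[OF g(1) y(1), of z] y out by blast
      qed
      \<comment> \<open>The triangle condition on \<open>t y\<close> first gives another point
        \<open>z\<close> of \<open>H\<close> as near to \<open>x\<close> as \<open>g\<close>; the
        quadrangle condition below \<open>t\<close> then applies to \<open>g\<close> and
        \<open>z\<close>.\<close>
      moreover have "d x y \<noteq> Suc (d x g)"
      proof
        assume e: "d x y = Suc (d x g)"
        then obtain z where z: "E z t" "E z y" "Suc (d x z) = Suc (d x g)"
          using TC[OF x t(2)] dt by auto
        have zH: "z \<in> H" using closed[OF tH y(1)] t z by blast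
        have zV: "z \<in> V" using zH H by blast
        have "g \<noteq> z" using z t by blast
        moreover have "\<not> E g z" using adj[OF zH] z by auto
        ultimately have dgz: "d g z = 2" using d_2I[of g t z] t z E_sym by blast
        obtain w where w: "E w g" "E w z" "Suc (d x w) = d x g"
          using QC[OF x t(1) z(1) \<open>g \<noteq> z\<close>] dt z by auto
        then show False using closed[OF g(1) zH, of w] dgz out by blast
      qed
      moreover have "d x y \<le> Suc (d x t)" using d_nb[OF x t(2)] .
      moreover have "d x g \<le> d x y" using g y by blast
      ultimately show ?thesis using dt by linarith
    qed
    have "d x g + d g y = d x y" if y: "y \<in> H" for y
    proof -
      have yV: "y \<in> V" using y H by blast
      show ?thesis
        by (cases rule: d_le_2_cases[OF gV yV diam[OF g(1) y]]) (use adj two y d_edge[of g y] in auto)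
    qed
    then show ?thesis using g(1) gV unfolding interval_iff by blast
  qed
  then show ?thesis using H unfolding gated_def by blast
qed

lemma quad_hull_gated:
  assumes "d u v = 2" "u \<in> V" "v \<in> V"
  shows "gated V E (quad_hull u v)"
proof (rule gatedI_diam2)
  show "quad_hull u v \<subseteq> V" "quad_hull u v \<noteq> {}" using assms unfolding quad_hull_def by auto
qed (use quad_hull_diam[OF assms] quad_hull_closed[OF assms] in blast)+

lemma quad_hull_base:
  assumes "d u v = 2" "u \<in> V" "v \<in> V"
  shows "u \<in> quad_hull u v" "v \<in> quad_hull u v"
  using assms unfolding quad_hull_def same_def by auto

section \<open>The axioms of dual polar graphs\<close>

lemma A34: "axiom_A34 V E"
  unfolding axiom_A34_def has_diameter_def
proof (intro ballI impI conjI)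
  fix u v assume uv: "u \<in> V" "v \<in> V" "d u v = 2"
  let ?H = "gated_hull V E {u, v}"
  have sub: "?H \<subseteq> quad_hull u v"
    using gated_hull_subset quad_hull_gated quad_hull_base uv by simp
  have gH: "gated V E ?H" using gated_hull_gated[of u "{u, v}"] uv by simp
  show "dist_le (induced E ?H) x y 2" if xy: "x \<in> ?H" "y \<in> ?H" for x y
  proof -
    have V: "x \<in> V" "y \<in> V" using gated_subset[OF gH] xy by auto
    have le: "d x y \<le> 2" using quad_hull_diam[OF uv(3,1,2)] sub xy by blast
    show ?thesis
    proof (cases rule: d_le_2_cases[OF V le])
      case 1
      then show ?thesis unfolding dist_le_def by (intro exI[of _ "[x]"]) simp
    next
      case 2
      then show ?thesis using xy unfolding dist_le_def by (intro exI[of _ "[x, y]"]) (simp add: induced_def)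
    next
      case 3
      then obtain t where t: "E x t" "E t y" using d_2E V by metis
      \<comment> \<open>The diameter is that of the induced subgraph, so the midpoint of the path
        must lie in the hull.\<close>
      then have "t \<in> ?H" using gated_common_nb[OF gH xy 3] by blast
      then show ?thesis using xy t unfolding dist_le_def
        by (intro exI[of _ "[x, t, y]"]) (simp add: induced_def)
    qed
  qed
  have "u \<in> ?H" "v \<in> ?H" using gated_hull_superset by blast+
  moreover have "\<not> dist_le (induced E ?H) u v (2 - 1)"
    using dist_le_induced[of ?H u v "2 - 1"] uv by auto
  ultimately show "\<exists>x\<in>?H. \<exists>y\<in>?H. \<not> dist_le (induced E ?H) x y (2 - 1)" by blast
qed

lemma A1: "axiom_A1 V E"
  unfolding axiom_A1_def
proof (intro allI impI)
  fix K assume K: "maximal_clique V E K"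
  have KV: "K \<subseteq> V" and cl: "\<And>x y. x \<in> K \<Longrightarrow> y \<in> K \<Longrightarrow> x \<noteq> y \<Longrightarrow> E x y"
    and max: "\<And>L. K \<subseteq> L \<Longrightarrow> L \<subseteq> V \<Longrightarrow> clique E L \<Longrightarrow> L = K"
    using K unfolding maximal_clique_def clique_def by blast+
  have absorb: "z \<in> K" if z: "z \<in> V" "\<And>x. x \<in> K \<Longrightarrow> x \<noteq> z \<Longrightarrow> E z x" for z
  proof -
    have "clique E (insert z K)" using z cl E_sym unfolding clique_def by blast
    then have "insert z K = K" using max[of "insert z K"] z KV by blast
    then show ?thesis by blast
  qed
  have ne: "K \<noteq> {}"
  proof
    assume "K = {}"
    moreover obtain z where "z \<in> V" using graph unfolding graph_def by blast
    ultimately show False using absorb by blast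
  qed
  show "gated V E K"
  proof (rule gatedI_diam2[OF KV ne])
    show "d x y \<le> 2" if "x \<in> K" "y \<in> K" for x y
      using cl[OF that] d_edge[of x y] by (cases "x = y") auto
    show "z \<in> K" if xyz: "x \<in> K" "y \<in> K" "E x y \<or> d x y = 2" "E z x" "E z y" for x y z
    proof (rule absorb)
      show "z \<in> V" using E_V xyz by blast
      have xy: "E x y" using xyz(3) cl[OF xyz(1,2)] d_self[of x] by fastforce
      \<comment> \<open>By \<open>K4\<close>, a vertex adjacent to two points of a clique is
        adjacent to all its other points.\<close>
      show "E z w" if "w \<in> K" "w \<noteq> z" for w
      proof (cases "w = x \<or> w = y")
        case True
        then show ?thesis using xyz by blast
      next
        case False
        then show ?thesis using K4[of z x y w] xyz xy cl that by blast
      qed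
    qed
  qed
qed

text \<open>Induction applied to a neighbour \<open>v'\<close> of \<open>v\<close> towards
  \<open>x\<close> gives \<open>w\<close> opposite to \<open>x\<close>. In the quad through
  \<open>w\<close> and \<open>v\<close>, the gate of \<open>u\<close> is \<open>w\<close> and that
  of \<open>x\<close> is \<open>v'\<close>; a second common neighbour \<open>y\<close> of
  \<open>w\<close> and \<open>v\<close> is at distance 2 from \<open>v'\<close>, hence two steps
  farther from \<open>x\<close>.\<close>

lemma A5_aux:
  "u \<in> V \<Longrightarrow> v \<in> V \<Longrightarrow> d u v = Suc (Suc n) \<Longrightarrow> E u x \<Longrightarrow> d x v = Suc n
    \<Longrightarrow> \<exists>y. E v y \<and> d u y = Suc n \<and> d x y = Suc (Suc n)"
proof (induction n arbitrary: v)
  case 0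
  then have x: "E x v" using d_1[of x v] E_V[of u x] by simp
  have n: "u \<noteq> v" "\<not> E u v" using d2D[of u v] 0 by auto
  obtain y where y: "E u y" "E y v" "y \<noteq> x" using thick2[OF 0(4) x n] by blast
  have "\<not> E x y" using common_nbs[OF 0(4) x y(1,2) n] .
  then have "d x y = 2" using d_2I[of x u y] y 0(4) E_sym by blast
  then show ?case using y d_edge[OF y(1)] E_sym[OF y(2)] by auto
next
  case (Suc n)
  have xV: "x \<in> V" using E_V Suc.prems(4) by blast
  obtain v' where v': "E v' v" "d x v' = Suc n" using d_pred[OF xV Suc.prems(2,5)] by blast
  have v'V: "v' \<in> V" using E_V v' by blast
  have "d u v' \<le> Suc (d x v')" using d_triangle[OF Suc.prems(1) xV v'V] d_edge[OF Suc.prems(4)] by simp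
  moreover have "d u v \<le> Suc (d u v')" using d_nb[OF Suc.prems(1) v'(1)] .
  ultimately have uv': "d u v' = Suc (Suc n)" using v' Suc.prems(3) by simp
  obtain w where w: "E v' w" "d u w = Suc n" "d x w = Suc (Suc n)"
    using Suc.IH[OF Suc.prems(1) v'V uv' Suc.prems(4) v'(2)] by blast
  have wV: "w \<in> V" using E_V w by blast
  have "w \<noteq> v" using w Suc.prems by auto
  moreover have "\<not> E w v" using d_nb[OF Suc.prems(1), of w v] w Suc.prems by auto
  ultimately have dwv: "d w v = 2" using d_2I[of w v' v] w v' E_sym by blast
  define Q where "Q = quad_hull w v"
  have Q: "gated V E Q" "w \<in> Q" "v \<in> Q" "\<And>a b. a \<in> Q \<Longrightarrow> b \<in> Q \<Longrightarrow> d a b \<le> 2"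
    using quad_hull_gated[OF dwv wV Suc.prems(2)] quad_hull_base[OF dwv wV Suc.prems(2)]
      quad_hull_diam[OF dwv wV Suc.prems(2)] unfolding Q_def by auto
  have v'Q: "v' \<in> Q" using gated_common_nb[OF Q(1-3) dwv] w v' E_sym by blast
  have QV: "Q \<subseteq> V" using gated_subset Q(1) .
  \<comment> \<open>Since \<open>v\<close> is two steps farther from \<open>u\<close> than
    \<open>w\<close> and the quad has diameter 2, the gate of \<open>u\<close> is \<open>w\<close>,
    the only nearest point.\<close>
  have near_u: "h = w" if h: "h \<in> Q" "d u h \<le> Suc n" for h
  proof -
    obtain g where g: "g \<in> Q" "\<And>y. y \<in> Q \<Longrightarrow> d u y = d u g + d g y"
      using gated_gate[OF Q(1) Suc.prems(1)] by blast
    have "d u v = d u g + d g v" "d u w = d u g + d g w" "d u h = d u g + d g h"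
      using g(2)[OF Q(3)] g(2)[OF Q(2)] g(2)[OF h(1)] .
    moreover have "d g v \<le> 2" using Q(4) g(1) Q(3) by blast
    ultimately have "d g w = 0" "d g h = 0" using w(2) h(2) Suc.prems(3) by linarith+
    then show ?thesis using d_0_iff QV g(1) h(1) wV by (metis subsetD)
  qed
  obtain g where g: "g \<in> Q" "\<And>y. y \<in> Q \<Longrightarrow> d x y = d x g + d g y"
    using gated_gate[OF Q(1) xV] by blast
  have gV: "g \<in> V" using QV g(1) by blast
  have gx: "d x v' = d x g + d g v'" using g(2)[OF v'Q] .
  \<comment> \<open>Any other gate would be within \<open>Suc n\<close> of \<open>u\<close> and so
    equal \<open>w\<close>, which is too far from \<open>x\<close>.\<close>
  have gv': "g = v'"
  proof (rule ccontr)
    assume "g \<noteq> v'"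
    then have "d g v' \<noteq> 0" using d_0_iff gV v'V by blast
    then have "d x g \<le> n" using gx v' by linarith
    moreover have "d u g \<le> d u x + d x g" using d_triangle Suc.prems(1) xV gV by blast
    ultimately have "d u g \<le> Suc n" using d_edge[OF Suc.prems(4)] by simp
    then have "g = w" using near_u g(1) by blast
    then show False using \<open>d x g \<le> n\<close> w by simp
  qed
  have wv: "w \<noteq> v" "\<not> E w v" using d2D dwv by auto
  obtain y where y: "E w y" "E y v" "y \<noteq> v'" using thick2[OF E_sym[OF w(1)] v'(1) wv] by blast
  have yQ: "y \<in> Q" using gated_common_nb[OF Q(1-3) dwv] y by blast
  have "\<not> E v' y" using common_nbs[OF E_sym[OF w(1)] v'(1) y(1,2) wv] .
  then have "d v' y = 2" using d_2I[of v' w y] w y E_sym by blast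
  then have "d x y = d x v' + 2" using g(2)[OF yQ] gv' by simp
  moreover have "d u y = Suc (Suc n)"
    using d_nb[OF Suc.prems(1) y(1)] d_nb[OF Suc.prems(1) y(2)] w(2) Suc.prems(3) by linarith
  ultimately show ?case using v'(2) E_sym[OF y(2)] by auto
qed

lemma A5: "axiom_A5 V E"
  unfolding axiom_A5_def
proof (intro ballI allI impI)
  fix u v x assume uv: "u \<in> V" "v \<in> V" and "\<not> E u v \<and> E u x \<and> x \<in> interval V E u v"
  then have h: "\<not> E u v" "E u x" "d u x + d x v = d u v" unfolding interval_iff by auto
  have ux: "d u x = 1" using d_edge h by blast
  have "d u v \<noteq> 1" using h d_1 uv by blast
  then obtain n where n: "d u v = Suc (Suc n)" "d x v = Suc n"
    using h(3) ux by (metis One_nat_def add_0_right not0_implies_Suc plus_1_eq_Suc)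
  then obtain y where y: "E v y" "d u y = Suc n" "d x y = Suc (Suc n)"
    using A5_aux[OF uv n(1) h(2) n(2)] by blast
  have "y \<in> V" "d y v = 1" using E_V[OF y(1)] d_edge[OF E_sym[OF y(1)]] by auto
  then have "y \<in> interval V E u v" using y n unfolding interval_iff by simp
  then show "\<exists>y. E v y \<and> y \<in> interval V E u v \<and>
           d u v = d x y \<and> d u v = d u y + 1 \<and> d u v = d x v + 1"
    using y n by auto
qed

lemma dual_polar: "dual_polar V E"
  using A1 A34 A5 unfolding dual_polar_def by blast

end

context conn_graph
begin

text \<open>The 4-cycle supplied by thickness need not pass through \<open>u\<close>,
  \<open>v\<close> or \<open>a\<close>, but a unique middle vertex would leave only three vertices
  in the interval.\<close>

lemma thick_common_nb:
  assumes "thick V E" and K4m: "\<not> contains_induced V E K4m_V K4m_E"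
    and "E u a" "E a v" "u \<noteq> v" "\<not> E u v"
  shows "\<exists>b. E u b \<and> E b v \<and> b \<noteq> a"
proof (rule ccontr)
  assume no: "\<not> ?thesis"
  have V: "u \<in> V" "v \<in> V" using E_V assms by auto
  have "d u v = 2" using d_2I assms by blast
  then obtain p q r s where c: "{p, q, r, s} \<subseteq> interval V E u v" "induced_4cycle E p q r s"
    using assms(1) V unfolding thick_def by blast
  have "x \<in> {u, a, v}" if x: "x \<in> interval V E u v" for x
  proof -
    have xV: "x \<in> V" "d u x + d x v = 2" using x \<open>d u v = 2\<close> unfolding interval_iff by auto
    then consider "d u x = 0" | "d x v = 0" | "d u x = 1" "d x v = 1" by linarith
    then show ?thesis using no d_0_iff[of u x] d_0_iff[of x v] d_1[of u x] d_1[of x v] V xV by cases auto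
  qed
  then have sub: "{p, q, r, s} \<subseteq> {u, a, v}" using c(1) by blast
  have "card {p, q, r, s} = 4" using c(2) unfolding induced_4cycle_def by simp
  moreover have "card {p, q, r, s} \<le> card {u, a, v}" using sub by (intro card_mono) auto
  moreover have "card {u, a, v} \<le> 3" by (simp add: card_insert_if)
  ultimately show False by linarith
qed

lemma thick_swm_dual_polar:
  assumes "thick V E" "weakly_modular V E" "\<not> contains_induced V E K4m_V K4m_E"
    "\<not> contains_isometric V E K33m_V K33m_E"
  shows "dual_polar V E"
proof -
  interpret thick_swm_graph V E
  proof (unfold_locales, goal_cases)
    case 1 then show ?case using weakly_modular_TC[OF assms(2)] by blast
  next
    case 2 then show ?case using weakly_modular_QC[OF assms(2)] by blast
  next
    case (3 a b c x)
    have "{a, b, c, x} \<subseteq> V" using 3 E_V by blast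
    moreover have "symp E" "irreflp E" using E_sym E_irrefl by (auto intro: sympI irreflpI)
    ultimately show ?case using not_contains_K4mD[OF assms(3), of a b c x] 3 by blast
  next
    case (4 s p p' t q q')
    have "d s t \<le> 3" using d_path3[of s p q t] 4 E_sym by blast
    moreover have "d s t \<noteq> 3" using contains_K33mI[of s p p' t q q'] 4 assms(4) by blast
    ultimately show ?case by linarith
  next
    case 5 then show ?case using thick_common_nb[OF assms(1,3)] by blast
  qed
  show ?thesis by (rule dual_polar)
qed

end

theorem theorem5p2:
  fixes V :: "'a set" and E :: "'a \<Rightarrow> 'a \<Rightarrow> bool"
  assumes "graph V E"
  shows "(dual_polar V E \<longleftrightarrow>
            thick V E \<and> weakly_modular V E \<and>
            \<not> contains_induced V E K4m_V K4m_E \<and>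
            \<not> contains_isometric V E K33m_V K33m_E)
       \<and> (dual_polar V E \<longleftrightarrow>
            thick V E \<and> locally_weakly_modular V E \<and>
            \<not> contains_induced V E K4m_V K4m_E \<and>
            \<not> contains_isometric V E K33m_V K33m_E \<and>
            tsc_simply_connected E)"
proof -
  interpret conn_graph V E by unfold_locales (rule assms)
  show ?thesis
    using dp_thick dp_weakly_modular dp_no_K4m dp_no_K33m thick_swm_dual_polar weakly_modularI
      weakly_modular_locally weakly_modular_simply_connected by blast
qed

end
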